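(* Let $G$ be a total group object in the join restriction category $\mathrm{ParTop}$, i.e. a topological group, and let $M$ be a topological space. The category of classical principal $G$-bundles over $M$ is isomorphic to the subcategory of the category of categorical principal $G$-bundles in $\mathrm{ParTop}$ (and morphisms of principal $G$-bundles) where - the base space of every object is $M$, - the underlying fibre bundle of every object is totally fibred, - the projection map $q:P\to M$ of every object is surjective, - every morphism $(f,g):(P,M,q)\to(P',M,q')$ has the identity as its second component: $g=1_M$.
   Context: Composition is written in diagrammatic order: $fg$ means first $f$, then $g$. $\mathrm{ParTop}$: objects are topological spaces; morphisms $A\to B$ are continuous maps $U\to B$ from open subsets $U\subseteq A$; composition is that of partial maps; the restriction $\bar f$ of $f$ with domain $U$ is the partial identity on $U$. $f\le g$ means $f$ is a restriction of $g$; pairwise compatible maps (agreeing on overlaps) have a join $\bigvee$, their union; $f$ is total if $\bar f=1$; a restriction idempotent is an $e$ with $e=\bar e$; $f$ is a partial isomorphism with partial inverse $f^*$ if $ff^*=\bar f$, $f^*f=\overline{f^*}$. $\langle f,g\rangle$ is defined on the intersection of the domains. Categorical notions. A fibre bundle over $M$ with typical fibre $F$ is an object $E$ with a total map $q:E\to M$ and partial isomorphisms $\alpha_i:E\to M\times F$ ($i\in I$) with $\alpha_i\pi_0=\bar\alpha_iq$, $\bigvee_i\bar\alpha_i=1_E$, and for each $i$ a restriction idempotent $e_i:M\to M$ with $\overline{\alpha_i^*}=e_i\times1_F$. It is totally fibred if $\bar\alpha_i=\overline{qe_i}$ for all $i$. For a group object $(G,m,u,\iota)$ with total structure maps, a $G$-atlas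 on $M$ is a family $\tau_{ij}:M\to G$ with $\langle\tau_{ij},\tau_{jk}\rangle m\le\tau_{ik}$, $\tau_{ii}\le\,!u$, $\tau_{ji}=\tau_{ij}\iota$. A principal $G$-bundle over $M$ is a fibre bundle $(P,M,q,(\alpha_i))$ with fibre $G$ and a $G$-atlas $(\tau_{ij})$ such that $\alpha_i^*\alpha_j=\langle\pi_0,\langle\pi_0\tau_{ji},\pi_1\rangle m\rangle:M\times G\to M\times G$. It carries the total right action $r_P=\bigvee_i(\alpha_i\times1_G)(1_M\times m)\alpha_i^*:P\times G\to P$. A morphism of principal $G$-bundles $(P,M)\to(P',M')$ is a pair of (possibly partial) maps $\Phi:P\to P'$, $\phi:M\to M'$ with $\Phi q'=q\phi$ and $r_P\Phi=(\Phi\times1_G)r_{P'}$. Classical notions. A classical principal $G$-bundle over $M$ is a space $P$ with continuous right $G$-action and a continuous $G$-map $q:P\to M$ ($G$ acting trivially on $M$), together with an open cover $(U_i)_{i\in I}$ of $M$ and $G$-equivariant homeomorphisms $\phi_i:q^{-1}(U_i)\to U_i\times G$ with $\phi_i\pi_0=q$, where $U_i\times G$ has the action $(x,g)h=(x,gh)$; i.e. an object is a tuple $(P,M,q,(U_i)_{i\in I},(\phi_i)_{i\in I})$. A morphism is a $G$-equivariant continuous map $\sigma:P\to P'$ with $\sigma q'=q$. *)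

theory Defs
  imports "HOL-Analysis.Analysis" "HOL-Algebra.Group"
begin

section \<open>Categories, subcategories and isomorphism of categories\<close>

text \<open>Identities and composition take the objects involved as arguments because an arrow is
  represented by its underlying function only. Composition is written in diagrammatic order.\<close>

record ('o, 'a) category =
  Obj :: "'o set"
  Hom :: "'o \<Rightarrow> 'o \<Rightarrow> 'a set"
  Id :: "'o \<Rightarrow> 'a"
  Comp :: "'o \<Rightarrow> 'o \<Rightarrow> 'o \<Rightarrow> 'a \<Rightarrow> 'a \<Rightarrow> 'a"

definition is_category :: "('o, 'a) category \<Rightarrow> bool" where
  "is_category C \<longleftrightarrow>
     (\<forall>X\<in>Obj C. Id C X \<in> Hom C X X) \<and>
     (\<forall>X\<in>Obj C. \<forall>Y\<in>Obj C. \<forall>Z\<in>Obj C. \<forall>f\<in>Hom C X Y. \<forall>g\<in>Hom C Y Z.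
        Comp C X Y Z f g \<in> Hom C X Z) \<and>
     (\<forall>X\<in>Obj C. \<forall>Y\<in>Obj C. \<forall>f\<in>Hom C X Y.
        Comp C X X Y (Id C X) f = f \<and> Comp C X Y Y f (Id C Y) = f) \<and>
     (\<forall>W\<in>Obj C. \<forall>X\<in>Obj C. \<forall>Y\<in>Obj C. \<forall>Z\<in>Obj C.
        \<forall>f\<in>Hom C W X. \<forall>g\<in>Hom C X Y. \<forall>h\<in>Hom C Y Z.
        Comp C W Y Z (Comp C W X Y f g) h = Comp C W X Z f (Comp C X Y Z g h))"

definition subcategory :: "('o, 'a) category \<Rightarrow> ('o, 'a) category \<Rightarrow> bool" where
  "subcategory D C \<longleftrightarrow> is_category C \<and> is_category D \<and> Obj D \<subseteq> Obj C \<and>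
     (\<forall>X\<in>Obj D. \<forall>Y\<in>Obj D. Hom D X Y \<subseteq> Hom C X Y) \<and>
     (\<forall>X\<in>Obj D. Id D X = Id C X) \<and>
     (\<forall>X\<in>Obj D. \<forall>Y\<in>Obj D. \<forall>Z\<in>Obj D. \<forall>f\<in>Hom D X Y. \<forall>g\<in>Hom D Y Z.
        Comp D X Y Z f g = Comp C X Y Z f g)"

definition is_functor ::
  "('o, 'a) category \<Rightarrow> ('p, 'b) category \<Rightarrow> ('o \<Rightarrow> 'p) \<Rightarrow> ('o \<Rightarrow> 'o \<Rightarrow> 'a \<Rightarrow> 'b) \<Rightarrow> bool" where
  "is_functor C D Fo Fa \<longleftrightarrow>
     (\<forall>X\<in>Obj C. Fo X \<in> Obj D) \<and>
     (\<forall>X\<in>Obj C. \<forall>Y\<in>Obj C. \<forall>f\<in>Hom C X Y. Fa X Y f \<in> Hom D (Fo X) (Fo Y)) \<and>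
     (\<forall>X\<in>Obj C. Fa X X (Id C X) = Id D (Fo X)) \<and>
     (\<forall>X\<in>Obj C. \<forall>Y\<in>Obj C. \<forall>Z\<in>Obj C. \<forall>f\<in>Hom C X Y. \<forall>g\<in>Hom C Y Z.
        Fa X Z (Comp C X Y Z f g) = Comp D (Fo X) (Fo Y) (Fo Z) (Fa X Y f) (Fa Y Z g))"

definition isomorphic_categories :: "('o, 'a) category \<Rightarrow> ('p, 'b) category \<Rightarrow> bool" where
  "isomorphic_categories C D \<longleftrightarrow> is_category C \<and> is_category D \<and>
     (\<exists>Fo Fa Go Ga. is_functor C D Fo Fa \<and> is_functor D C Go Ga \<and>
        (\<forall>X\<in>Obj C. Go (Fo X) = X) \<and>
        (\<forall>X\<in>Obj C. \<forall>Y\<in>Obj C. \<forall>f\<in>Hom C X Y. Ga (Fo X) (Fo Y) (Fa X Y f) = f) \<and>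
        (\<forall>X\<in>Obj D. Fo (Go X) = X) \<and>
        (\<forall>X\<in>Obj D. \<forall>Y\<in>Obj D. \<forall>f\<in>Hom D X Y. Fa (Go X) (Go Y) (Ga X Y f) = f))"


section \<open>The join restriction category ParTop\<close>

text \<open>A topological space is a value of type \<open>'a topology\<close>; a partial map is a value of type
  \<open>'a \<rightharpoonup> 'b\<close>, so that equality of arrows is equality of partial functions. The order of the
  restriction category is the library's \<open>\<subseteq>\<^sub>m\<close>.\<close>

definition partop :: "'a topology \<Rightarrow> 'b topology \<Rightarrow> ('a \<rightharpoonup> 'b) set" where
  "partop A B =
     {f. openin A (dom f) \<and> continuous_map (subtopology A (dom f)) B (\<lambda>x. the (f x))}"

definition pcomp :: "('a \<rightharpoonup> 'b) \<Rightarrow> ('b \<rightharpoonup> 'c) \<Rightarrow> ('a \<rightharpoonup> 'c)" (infixl "\<Zcomp>" 70) where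
  "f \<Zcomp> g = g \<circ>\<^sub>m f"

definition pid :: "'a topology \<Rightarrow> ('a \<rightharpoonup> 'a)" where
  "pid A = (\<lambda>x. if x \<in> topspace A then Some x else None)"

definition rst :: "('a \<rightharpoonup> 'b) \<Rightarrow> ('a \<rightharpoonup> 'a)" where
  "rst f = (\<lambda>x. if x \<in> dom f then Some x else None)"

definition total_map :: "'a topology \<Rightarrow> 'b topology \<Rightarrow> ('a \<rightharpoonup> 'b) \<Rightarrow> bool" where
  "total_map A B f \<longleftrightarrow> f \<in> partop A B \<and> rst f = pid A"

definition restriction_idempotent :: "'a topology \<Rightarrow> ('a \<rightharpoonup> 'a) \<Rightarrow> bool" where
  "restriction_idempotent A e \<longleftrightarrow> e \<in> partop A A \<and> rst e = e"

definition partial_inverse ::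
  "'a topology \<Rightarrow> 'b topology \<Rightarrow> ('a \<rightharpoonup> 'b) \<Rightarrow> ('b \<rightharpoonup> 'a) \<Rightarrow> bool" where
  "partial_inverse A B f g \<longleftrightarrow>
     f \<in> partop A B \<and> g \<in> partop B A \<and> f \<Zcomp> g = rst f \<and> g \<Zcomp> f = rst g"

definition partial_iso :: "'a topology \<Rightarrow> 'b topology \<Rightarrow> ('a \<rightharpoonup> 'b) \<Rightarrow> bool" where
  "partial_iso A B f \<longleftrightarrow> (\<exists>g. partial_inverse A B f g)"

definition pinv :: "'a topology \<Rightarrow> 'b topology \<Rightarrow> ('a \<rightharpoonup> 'b) \<Rightarrow> ('b \<rightharpoonup> 'a)" where
  "pinv A B f = (THE g. partial_inverse A B f g)"

text \<open>The join of a family that agrees on overlaps, i.e. its union; otherwise the value at a point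
  of overlap is an arbitrary choice.\<close>

definition pjoin :: "'i set \<Rightarrow> ('i \<Rightarrow> 'a \<rightharpoonup> 'b) \<Rightarrow> ('a \<rightharpoonup> 'b)" where
  "pjoin I f =
     (\<lambda>x. if \<exists>i\<in>I. x \<in> dom (f i) then f (SOME i. i \<in> I \<and> x \<in> dom (f i)) x else None)"

definition pone :: "unit topology" where
  "pone = discrete_topology {()}"

definition pbang :: "'a topology \<Rightarrow> ('a \<rightharpoonup> unit)" where
  "pbang A = (\<lambda>x. if x \<in> topspace A then Some () else None)"

definition ppi0 :: "'a topology \<Rightarrow> 'b topology \<Rightarrow> ('a \<times> 'b \<rightharpoonup> 'a)" where
  "ppi0 A B = (\<lambda>z. if z \<in> topspace A \<times> topspace B then Some (fst z) else None)"

definition ppi1 :: "'a topology \<Rightarrow> 'b topology \<Rightarrow> ('a \<times> 'b \<rightharpoonup> 'b)" where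
  "ppi1 A B = (\<lambda>z. if z \<in> topspace A \<times> topspace B then Some (snd z) else None)"

definition ppair :: "('a \<rightharpoonup> 'b) \<Rightarrow> ('a \<rightharpoonup> 'c) \<Rightarrow> ('a \<rightharpoonup> 'b \<times> 'c)" where
  "ppair f g =
     (\<lambda>x. if x \<in> dom f \<inter> dom g then Some (the (f x), the (g x)) else None)"

definition ptimes :: "('a \<rightharpoonup> 'b) \<Rightarrow> ('c \<rightharpoonup> 'd) \<Rightarrow> ('a \<times> 'c \<rightharpoonup> 'b \<times> 'd)"
    (infixr "\<times>\<^sub>p" 80) where
  "f \<times>\<^sub>p g =
     (\<lambda>(x, y). if x \<in> dom f \<and> y \<in> dom g then Some (the (f x), the (g y)) else None)"

definition passoc ::
  "'a topology \<Rightarrow> 'b topology \<Rightarrow> 'c topology \<Rightarrow> (('a \<times> 'b) \<times> 'c \<rightharpoonup> 'a \<times> 'b \<times> 'c)" where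
  "passoc A B C =
     ppair (ppi0 (prod_topology A B) C \<Zcomp> ppi0 A B)
       (ppair (ppi0 (prod_topology A B) C \<Zcomp> ppi1 A B) (ppi1 (prod_topology A B) C))"

lemma partop_pcomp:
  assumes "f \<in> partop A B" "g \<in> partop B C"
  shows "f \<Zcomp> g \<in> partop A C"
proof -
  have f: "openin A (dom f)" "continuous_map (subtopology A (dom f)) B (\<lambda>x. the (f x))"
    and g: "openin B (dom g)" "continuous_map (subtopology B (dom g)) C (\<lambda>x. the (g x))"
    using assms by (auto simp: partop_def)
  have d: "dom (f \<Zcomp> g) = {x \<in> topspace (subtopology A (dom f)). the (f x) \<in> dom g}"
    using openin_subset[OF f(1)]
    by (auto simp: pcomp_def map_comp_def dom_def split: option.splits)
  have "openin (subtopology A (dom f)) (dom (f \<Zcomp> g))"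
    unfolding d using openin_continuous_map_preimage[OF f(2) g(1)] .
  hence o: "openin A (dom (f \<Zcomp> g))" using f(1) openin_trans_full by blast
  have sub: "dom (f \<Zcomp> g) \<subseteq> dom f"
    by (auto simp: pcomp_def map_comp_def dom_def split: option.splits)
  have "continuous_map (subtopology A (dom (f \<Zcomp> g))) B (\<lambda>x. the (f x))"
    using continuous_map_from_subtopology_mono[OF f(2) sub] .
  hence "continuous_map (subtopology A (dom (f \<Zcomp> g))) (subtopology B (dom g)) (\<lambda>x. the (f x))"
    using d by (auto simp: continuous_map_in_subtopology)
  from continuous_map_compose[OF this g(2)]
  have "continuous_map (subtopology A (dom (f \<Zcomp> g))) C (\<lambda>x. the ((f \<Zcomp> g) x))"
    by (rule continuous_map_eq) (auto simp: pcomp_def map_comp_def dom_def split: option.splits)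
  with o show ?thesis by (simp add: partop_def)
qed

lemma partop_pid: "pid A \<in> partop A A"
proof -
  have d: "dom (pid A) = topspace A" by (auto simp: pid_def dom_def)
  have "continuous_map A A (\<lambda>x. the (pid A x))"
    by (rule continuous_map_eq[OF continuous_map_id]) (auto simp: pid_def)
  thus ?thesis by (simp add: partop_def d subtopology_topspace)
qed

lemma pcomp_assoc: "(f \<Zcomp> g) \<Zcomp> h = f \<Zcomp> (g \<Zcomp> h)"
  by (auto simp: pcomp_def map_comp_def split: option.splits)

lemma partop_values:
  assumes "f \<in> partop A B" "f x = Some y"
  shows "x \<in> topspace A" "y \<in> topspace B"
proof -
  have f: "openin A (dom f)" "continuous_map (subtopology A (dom f)) B (\<lambda>x. the (f x))"
    using assms by (auto simp: partop_def)
  have x: "x \<in> dom f" using assms by auto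
  show "x \<in> topspace A" using x openin_subset[OF f(1)] by auto
  with x have "the (f x) \<in> topspace B" using f(2) by (auto simp: continuous_map_def)
  thus "y \<in> topspace B" using assms by simp
qed

lemma pid_pcomp:
  assumes "\<And>x y. f x = Some y \<Longrightarrow> x \<in> topspace A" shows "pid A \<Zcomp> f = f"
proof
  fix x show "(pid A \<Zcomp> f) x = f x"
    using assms[of x] by (cases "f x") (auto simp: pcomp_def map_comp_def pid_def)
qed

lemma pcomp_pid:
  assumes "\<And>x y. f x = Some y \<Longrightarrow> y \<in> topspace B" shows "f \<Zcomp> pid B = f"
proof
  fix x show "(f \<Zcomp> pid B) x = f x"
    using assms[of x] by (cases "f x") (auto simp: pcomp_def map_comp_def pid_def)
qed

lemma ptimes_Some: "(f \<times>\<^sub>p g) (x, y) = Some z \<longleftrightarrow>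
    (\<exists>a b. f x = Some a \<and> g y = Some b \<and> z = (a, b))"
  by (auto simp: ptimes_def)

lemma ptimes_pcomp: "(f \<Zcomp> g) \<times>\<^sub>p (h \<Zcomp> k) = (f \<times>\<^sub>p h) \<Zcomp> (g \<times>\<^sub>p k)"
proof
  fix z show "((f \<Zcomp> g) \<times>\<^sub>p (h \<Zcomp> k)) z = ((f \<times>\<^sub>p h) \<Zcomp> (g \<times>\<^sub>p k)) z"
    by (cases z; cases "f (fst z)"; cases "h (snd z)")
      (auto simp: ptimes_def pcomp_def map_comp_def dom_def)
qed

lemma ptimes_pid: "pid A \<times>\<^sub>p pid B = pid (prod_topology A B)"
  by (rule ext) (auto simp: ptimes_def pid_def dom_def split: if_splits)

lemma pinv_eq:
  assumes "partial_inverse A B f g" shows "pinv A B f = g"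
  unfolding pinv_def
proof (rule the_equality)
  show "partial_inverse A B f g" by fact
next
  have *: "k y = Some x \<longleftrightarrow> f x = Some y" if "partial_inverse A B f k" for k x y
  proof -
    from that have 1: "f \<Zcomp> k = rst f" and 2: "k \<Zcomp> f = rst k"
      by (auto simp: partial_inverse_def)
    show ?thesis using fun_cong[OF 1, of x] fun_cong[OF 2, of y]
      by (auto simp: pcomp_def map_comp_def rst_def dom_def split: option.splits if_splits)
  qed
  fix h assume h: "partial_inverse A B f h"
  show "h = g"
  proof
    fix y show "h y = g y" using *[OF h, of y] *[OF assms, of y]
      by (metis option.exhaust)
  qed
qed


section \<open>Group objects and topological groups\<close>

record 'g group_data =
  gsp :: "'g topology"
  gmul :: "'g \<times> 'g \<rightharpoonup> 'g"
  gunit :: "unit \<rightharpoonup> 'g"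
  ginv :: "'g \<rightharpoonup> 'g"

definition group_object :: "'g group_data \<Rightarrow> bool" where
  "group_object G \<longleftrightarrow>
     (let X = gsp G; m = gmul G; u = gunit G; \<iota> = ginv G in
       total_map (prod_topology X X) X m \<and> total_map pone X u \<and> total_map X X \<iota> \<and>
       (m \<times>\<^sub>p pid X) \<Zcomp> m = passoc X X X \<Zcomp> (pid X \<times>\<^sub>p m) \<Zcomp> m \<and>
       ppair (pbang X \<Zcomp> u) (pid X) \<Zcomp> m = pid X \<and>
       ppair (pid X) (pbang X \<Zcomp> u) \<Zcomp> m = pid X \<and>
       ppair \<iota> (pid X) \<Zcomp> m = pbang X \<Zcomp> u \<and>
       ppair (pid X) \<iota> \<Zcomp> m = pbang X \<Zcomp> u)"

definition points :: "'g group_data \<Rightarrow> 'g monoid" where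
  "points G = \<lparr>carrier = topspace (gsp G),
               monoid.mult = (\<lambda>g h. the (gmul G (g, h))),
               one = the (gunit G ())\<rparr>"

definition topological_group :: "'g topology \<Rightarrow> 'g monoid \<Rightarrow> bool" where
  "topological_group T H \<longleftrightarrow> group H \<and> carrier H = topspace T \<and>
     continuous_map (prod_topology T T) T (\<lambda>(g, h). g \<otimes>\<^bsub>H\<^esub> h) \<and>
     continuous_map T T (\<lambda>g. inv\<^bsub>H\<^esub> g)"

lemma group_object_topological_group:
  assumes "group_object G" shows "topological_group (gsp G) (points G)"
proof -
  define X where "X = gsp G"
  define mm where "mm = (\<lambda>g h. the (gmul G (g, h)))"
  define uu where "uu = the (gunit G ())"
  define ii where "ii = (\<lambda>g. the (ginv G g))"
  note a = assms[unfolded group_object_def Let_def, folded X_def]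
  have tot: "f x = Some (the (f x)) \<and> the (f x) \<in> topspace B" 
    if "total_map A B f" "x \<in> topspace A" for A :: "'x topology" and B :: "'y topology" and f x
  proof -
    from that(1) have "f \<in> partop A B" "rst f x = pid A x" by (auto simp: total_map_def)
    with that(2) show ?thesis using partop_values(2)[of f A B x]
      by (auto simp: rst_def pid_def split: if_splits)
  qed
  have totd: "dom f = topspace A" if "total_map A B f" for A :: "'x topology" and B :: "'y topology" and f
  proof -
    from that have "rst f = pid A" by (auto simp: total_map_def)
    hence "rst f x = pid A x" for x by simp
    thus ?thesis by (fastforce simp: rst_def pid_def split: if_splits)
  qed
  have cont: "continuous_map A B (\<lambda>x. the (f x))" if "total_map A B f" 
      for A :: "'x topology" and B :: "'y topology" and f
    using that totd[OF that] by (auto simp: total_map_def partop_def)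
  have m: "gmul G (g,h) = Some (mm g h)" "mm g h \<in> topspace X"
     if "g \<in> topspace X" "h \<in> topspace X" for g h
    using tot[of "prod_topology X X" X "gmul G" "(g,h)"] a that by (auto simp: mm_def)
  have u: "gunit G () = Some uu" "uu \<in> topspace X"
    using tot[of pone X "gunit G" "()"] a by (auto simp: uu_def pone_def)
  have i: "ginv G g = Some (ii g)" "ii g \<in> topspace X" if "g \<in> topspace X" for g
    using tot[of X X "ginv G" g] a that by (auto simp: ii_def)
  have as: "mm (mm g h) k = mm g (mm h k)" 
    if "g \<in> topspace X" "h \<in> topspace X" "k \<in> topspace X" for g h k
  proof -
    from a have "((gmul G \<times>\<^sub>p pid X) \<Zcomp> gmul G) ((g,h),k) 
       = (passoc X X X \<Zcomp> (pid X \<times>\<^sub>p gmul G) \<Zcomp> gmul G) ((g,h),k)" by simp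
    thus ?thesis using that 
      by (simp add: pcomp_def map_comp_def ptimes_def passoc_def ppair_def ppi0_def ppi1_def pid_def m dom_def)
  qed
  have un: "mm uu g = g" "mm (ii g) g = uu" "mm g (ii g) = uu" "mm g uu = g" if "g \<in> topspace X" for g
  proof -
    from a have "(ppair (pbang X \<Zcomp> gunit G) (pid X) \<Zcomp> gmul G) g = pid X g"
      "(ppair (ginv G) (pid X) \<Zcomp> gmul G) g = (pbang X \<Zcomp> gunit G) g"
      "(ppair (pid X) (ginv G) \<Zcomp> gmul G) g = (pbang X \<Zcomp> gunit G) g"
      "(ppair (pid X) (pbang X \<Zcomp> gunit G) \<Zcomp> gmul G) g = pid X g" by simp_all
    thus "mm uu g = g" "mm (ii g) g = uu" "mm g (ii g) = uu" "mm g uu = g" using that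
      by (simp_all add: pcomp_def map_comp_def ppair_def pid_def pbang_def m u i dom_def)
  qed
  have H: "points G = \<lparr>carrier = topspace X, monoid.mult = mm, one = uu\<rparr>"
    by (simp add: points_def X_def mm_def uu_def)
  have grp: "group (points G)"
    unfolding H by (rule groupI) (auto simp: m u i as un intro: i(2) un(2))
  have inv: "ii g = inv\<^bsub>points G\<^esub> g" if "g \<in> topspace X" for g
    by (rule group.inv_equality[OF grp, symmetric]) (auto simp: H that un i)
  have "continuous_map (prod_topology X X) X (\<lambda>x. the (gmul G x))"
    by (rule cont) (use a in blast)
  then have mc: "continuous_map (prod_topology X X) X (\<lambda>(g, h). g \<otimes>\<^bsub>points G\<^esub> h)"
    by (rule continuous_map_eq) (auto simp: H mm_def)
  have "continuous_map X X (\<lambda>x. the (ginv G x))"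
    by (rule cont) (use a in blast)
  then have ic: "continuous_map X X (\<lambda>g. inv\<^bsub>points G\<^esub> g)"
    by (rule continuous_map_eq) (simp add: inv[symmetric] ii_def)
  show ?thesis using grp mc ic by (simp add: topological_group_def X_def[symmetric]) (simp add: H)
qed


section \<open>Fibre bundles and principal bundles in ParTop\<close>

text \<open>The idempotents \<open>e i\<close> and the atlas \<open>\<tau>\<close> are part of the data; for a group as fibre (which is
  nonempty) they are determined by the charts.\<close>

definition fibre_bundle ::
  "'p topology \<Rightarrow> 'm topology \<Rightarrow> 'f topology \<Rightarrow> ('p \<rightharpoonup> 'm) \<Rightarrow> 'i set \<Rightarrow>
   ('i \<Rightarrow> 'p \<rightharpoonup> 'm \<times> 'f) \<Rightarrow> ('i \<Rightarrow> 'm \<rightharpoonup> 'm) \<Rightarrow> bool" where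
  "fibre_bundle E M F q I \<alpha> e \<longleftrightarrow>
     total_map E M q \<and>
     (\<forall>i\<in>I. partial_iso E (prod_topology M F) (\<alpha> i)) \<and>
     (\<forall>i\<in>I. \<alpha> i \<Zcomp> ppi0 M F = rst (\<alpha> i) \<Zcomp> q) \<and>
     pjoin I (\<lambda>i. rst (\<alpha> i)) = pid E \<and>
     (\<forall>i\<in>I. restriction_idempotent M (e i)) \<and>
     (\<forall>i\<in>I. rst (pinv E (prod_topology M F) (\<alpha> i)) = e i \<times>\<^sub>p pid F)"

definition totally_fibred ::
  "('p \<rightharpoonup> 'm) \<Rightarrow> 'i set \<Rightarrow> ('i \<Rightarrow> 'p \<rightharpoonup> 'm \<times> 'f) \<Rightarrow> ('i \<Rightarrow> 'm \<rightharpoonup> 'm) \<Rightarrow> bool" where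
  "totally_fibred q I \<alpha> e \<longleftrightarrow> (\<forall>i\<in>I. rst (\<alpha> i) = rst (q \<Zcomp> e i))"

definition group_atlas ::
  "'g group_data \<Rightarrow> 'm topology \<Rightarrow> 'i set \<Rightarrow> ('i \<times> 'i \<Rightarrow> 'm \<rightharpoonup> 'g) \<Rightarrow> bool" where
  "group_atlas G M I \<tau> \<longleftrightarrow>
     (\<forall>i\<in>I. \<forall>j\<in>I. \<tau> (i, j) \<in> partop M (gsp G)) \<and>
     (\<forall>i\<in>I. \<forall>j\<in>I. \<forall>k\<in>I. ppair (\<tau> (i, j)) (\<tau> (j, k)) \<Zcomp> gmul G \<subseteq>\<^sub>m \<tau> (i, k)) \<and>
     (\<forall>i\<in>I. \<tau> (i, i) \<subseteq>\<^sub>m pbang M \<Zcomp> gunit G) \<and>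
     (\<forall>i\<in>I. \<forall>j\<in>I. \<tau> (j, i) = \<tau> (i, j) \<Zcomp> ginv G)"

record ('p, 'm, 'g, 'i) pbundle =
  ptotal :: "'p topology"
  pbase :: "'m topology"
  pproj :: "'p \<rightharpoonup> 'm"
  pindex :: "'i set"
  pchart :: "'i \<Rightarrow> 'p \<rightharpoonup> 'm \<times> 'g"
  pdom :: "'i \<Rightarrow> 'm \<rightharpoonup> 'm"
  ptrans :: "'i \<times> 'i \<Rightarrow> 'm \<rightharpoonup> 'g"

abbreviation pchart_inv ::
  "'g group_data \<Rightarrow> ('p, 'm, 'g, 'i) pbundle \<Rightarrow> 'i \<Rightarrow> 'm \<times> 'g \<rightharpoonup> 'p" where
  "pchart_inv G P i \<equiv> pinv (ptotal P) (prod_topology (pbase P) (gsp G)) (pchart P i)"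

text \<open>The requirements \<open>_ \<in> extensional _\<close> fix the irrelevant values of indexed families outside
  their index set, so that equality of records is equality of bundles.\<close>

definition principal_bundle :: "'g group_data \<Rightarrow> ('p, 'm, 'g, 'i) pbundle \<Rightarrow> bool" where
  "principal_bundle G P \<longleftrightarrow>
     (let M = pbase P; X = gsp G; I = pindex P; \<alpha> = pchart P; \<tau> = ptrans P in
       \<alpha> \<in> extensional I \<and> pdom P \<in> extensional I \<and> \<tau> \<in> extensional (I \<times> I) \<and>
       fibre_bundle (ptotal P) M X (pproj P) I \<alpha> (pdom P) \<and>
       group_atlas G M I \<tau> \<and>
       (\<forall>i\<in>I. \<forall>j\<in>I. pchart_inv G P i \<Zcomp> \<alpha> j =
          ppair (ppi0 M X) (ppair (ppi0 M X \<Zcomp> \<tau> (j, i)) (ppi1 M X) \<Zcomp> gmul G)))"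

definition bundle_action ::
  "'g group_data \<Rightarrow> ('p, 'm, 'g, 'i) pbundle \<Rightarrow> ('p \<times> 'g \<rightharpoonup> 'p)" where
  "bundle_action G P =
     (let M = pbase P; X = gsp G in
       pjoin (pindex P) (\<lambda>i.
         (pchart P i \<times>\<^sub>p pid X) \<Zcomp> passoc M X X \<Zcomp> (pid M \<times>\<^sub>p gmul G) \<Zcomp> pchart_inv G P i))"

definition principal_bundle_morphisms ::
  "'g group_data \<Rightarrow> ('p, 'm, 'g, 'i) pbundle \<Rightarrow> ('p, 'm, 'g, 'i) pbundle \<Rightarrow>
   (('p \<rightharpoonup> 'p) \<times> ('m \<rightharpoonup> 'm)) set" where
  "principal_bundle_morphisms G P P' =
     {(\<Phi>, \<phi>). \<Phi> \<in> partop (ptotal P) (ptotal P') \<and> \<phi> \<in> partop (pbase P) (pbase P') \<and>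
        \<Phi> \<Zcomp> pproj P' = pproj P \<Zcomp> \<phi> \<and>
        bundle_action G P \<Zcomp> \<Phi> = (\<Phi> \<times>\<^sub>p pid (gsp G)) \<Zcomp> bundle_action G P'}"

definition principal_bundle_category ::
  "'g group_data \<Rightarrow>
   (('p, 'm, 'g, 'i) pbundle, ('p \<rightharpoonup> 'p) \<times> ('m \<rightharpoonup> 'm)) category" where
  "principal_bundle_category G =
     \<lparr>Obj = {P. principal_bundle G P},
      Hom = principal_bundle_morphisms G,
      Id = (\<lambda>P. (pid (ptotal P), pid (pbase P))),
      Comp = (\<lambda>P Q R f g. (fst f \<Zcomp> fst g, snd f \<Zcomp> snd g))\<rparr>"

definition totally_fibred_subcategory ::
  "'g group_data \<Rightarrow> 'm topology \<Rightarrow>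
   (('p, 'm, 'g, 'i) pbundle, ('p \<rightharpoonup> 'p) \<times> ('m \<rightharpoonup> 'm)) category" where
  "totally_fibred_subcategory G M =
     (let C = principal_bundle_category G in
     \<lparr>Obj = {P \<in> Obj C. pbase P = M \<and>
               totally_fibred (pproj P) (pindex P) (pchart P) (pdom P) \<and>
               ran (pproj P) = topspace M},
      Hom = (\<lambda>P P'. {(f, g) \<in> Hom C P P'. g = pid M}),
      Id = Id C,
      Comp = Comp C\<rparr>)"

lemma bundle_action_values:
  assumes P: "principal_bundle G P" and r: "bundle_action G P z = Some p"
  shows "z \<in> topspace (prod_topology (ptotal P) (gsp G))" "p \<in> topspace (ptotal P)"
proof -
  let ?t = "\<lambda>i. (pchart P i \<times>\<^sub>p pid (gsp G)) \<Zcomp> passoc (pbase P) (gsp G) (gsp G)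
         \<Zcomp> (pid (pbase P) \<times>\<^sub>p gmul G) \<Zcomp> pchart_inv G P i"
  from r obtain i where i: "i \<in> pindex P" "?t i z = Some p"
    unfolding bundle_action_def Let_def pjoin_def
    by (smt (verit, ccfv_SIG) option.distinct(1) someI_ex)
  from P i(1) have pi: "partial_iso (ptotal P) (prod_topology (pbase P) (gsp G)) (pchart P i)"
    by (auto simp: principal_bundle_def fibre_bundle_def Let_def)
  then obtain g where g: "partial_inverse (ptotal P) (prod_topology (pbase P) (gsp G)) (pchart P i) g"
    by (auto simp: partial_iso_def)
  have c: "pchart P i \<in> partop (ptotal P) (prod_topology (pbase P) (gsp G))"
    and d: "pchart_inv G P i \<in> partop (prod_topology (pbase P) (gsp G)) (ptotal P)"
    using g pinv_eq[OF g] by (auto simp: partial_inverse_def)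
  obtain x y where z: "z = (x, y)" by (cases z)
  from i(2) obtain w where w: "(pchart P i \<times>\<^sub>p pid (gsp G)) z = Some w"
    by (auto simp: pcomp_def map_comp_def split: option.splits)
  from i(2) obtain v where v: "pchart_inv G P i v = Some p"
    by (auto simp: pcomp_def map_comp_def split: option.splits)
  show "p \<in> topspace (ptotal P)" using partop_values[OF d v] by auto
  from w z obtain a b where "pchart P i x = Some a" "pid (gsp G) y = Some b"
    by (auto simp: ptimes_Some)
  thus "z \<in> topspace (prod_topology (ptotal P) (gsp G))"
    using partop_values(1)[OF c] by (auto simp: z pid_def split: if_splits)
qed

lemma principal_bundle_morphisms_id:
  assumes P: "principal_bundle G P"
  shows "(pid (ptotal P), pid (pbase P)) \<in> principal_bundle_morphisms G P P"
proof -
  have q: "pproj P \<in> partop (ptotal P) (pbase P)"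
    using P by (auto simp: principal_bundle_def fibre_bundle_def Let_def total_map_def)
  show ?thesis
    unfolding principal_bundle_morphisms_def
    using partop_values[OF q] bundle_action_values[OF P]
    by (simp add: partop_pid ptimes_pid pid_pcomp pcomp_pid)
qed

lemma principal_bundle_morphisms_comp:
  assumes f: "f \<in> principal_bundle_morphisms G P Q" and g: "g \<in> principal_bundle_morphisms G Q R"
  shows "(fst f \<Zcomp> fst g, snd f \<Zcomp> snd g) \<in> principal_bundle_morphisms G P R"
proof -
  from f g have 1: "fst f \<Zcomp> pproj Q = pproj P \<Zcomp> snd f" "fst g \<Zcomp> pproj R = pproj Q \<Zcomp> snd g"
    and 2: "bundle_action G P \<Zcomp> fst f = (fst f \<times>\<^sub>p pid (gsp G)) \<Zcomp> bundle_action G Q"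
      "bundle_action G Q \<Zcomp> fst g = (fst g \<times>\<^sub>p pid (gsp G)) \<Zcomp> bundle_action G R"
    by (auto simp: principal_bundle_morphisms_def)
  have "(fst f \<Zcomp> fst g) \<Zcomp> pproj R = pproj P \<Zcomp> (snd f \<Zcomp> snd g)"
    by (metis 1 pcomp_assoc)
  moreover have "pid (gsp G) \<Zcomp> pid (gsp G) = pid (gsp G)"
    by (rule pid_pcomp) (auto simp: pid_def split: if_splits)
  then have "(fst f \<Zcomp> fst g) \<times>\<^sub>p pid (gsp G) =
      (fst f \<times>\<^sub>p pid (gsp G)) \<Zcomp> (fst g \<times>\<^sub>p pid (gsp G))"
    by (metis ptimes_pcomp)
  then have "bundle_action G P \<Zcomp> (fst f \<Zcomp> fst g) =
      ((fst f \<Zcomp> fst g) \<times>\<^sub>p pid (gsp G)) \<Zcomp> bundle_action G R"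
    by (simp add: 2 pcomp_assoc flip: pcomp_assoc[of "bundle_action G P"])
  moreover have "fst f \<Zcomp> fst g \<in> partop (ptotal P) (ptotal R)"
    by (rule partop_pcomp[of _ _ "ptotal Q"])
      (use f g in \<open>auto simp: principal_bundle_morphisms_def\<close>)
  moreover have "snd f \<Zcomp> snd g \<in> partop (pbase P) (pbase R)"
    by (rule partop_pcomp[of _ _ "pbase Q"])
      (use f g in \<open>auto simp: principal_bundle_morphisms_def\<close>)
  ultimately show ?thesis
    by (simp add: principal_bundle_morphisms_def)
qed

lemma principal_bundle_morphisms_unit:
  assumes "f \<in> principal_bundle_morphisms G P Q"
  shows "(pid (ptotal P) \<Zcomp> fst f, pid (pbase P) \<Zcomp> snd f) = f"
    and "(fst f \<Zcomp> pid (ptotal Q), snd f \<Zcomp> pid (pbase Q)) = f"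
proof -
  have *: "fst f \<in> partop (ptotal P) (ptotal Q)" "snd f \<in> partop (pbase P) (pbase Q)"
    using assms by (auto simp: principal_bundle_morphisms_def)
  show "(pid (ptotal P) \<Zcomp> fst f, pid (pbase P) \<Zcomp> snd f) = f"
    by (simp add: prod_eq_iff pid_pcomp partop_values(1)[OF *(1)] partop_values(1)[OF *(2)])
  show "(fst f \<Zcomp> pid (ptotal Q), snd f \<Zcomp> pid (pbase Q)) = f"
    by (simp add: prod_eq_iff pcomp_pid partop_values(2)[OF *(1)] partop_values(2)[OF *(2)])
qed

lemma is_category_principal_bundle_category: "is_category (principal_bundle_category G)"
  unfolding is_category_def principal_bundle_category_def category.simps
  by (intro conjI ballI)
    (simp_all add: principal_bundle_morphisms_id principal_bundle_morphisms_comp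
       principal_bundle_morphisms_unit pcomp_assoc)

lemma subcategory_totally_fibred:
  "subcategory (totally_fibred_subcategory G M) (principal_bundle_category G)"
proof -
  have M: "pid A \<Zcomp> pid A = pid A" for A :: "'b topology"
    by (rule pid_pcomp) (auto simp: pid_def split: if_splits)
  have "is_category (totally_fibred_subcategory G M)"
    unfolding is_category_def
  proof (intro conjI ballI, goal_cases)
    case (1 X)
    then show ?case using principal_bundle_morphisms_id[of G X]
      by (auto simp: totally_fibred_subcategory_def principal_bundle_category_def)
  next
    case (2 X Y Z f g)
    then show ?case using principal_bundle_morphisms_comp[of f G X Y g Z]
      by (auto simp: totally_fibred_subcategory_def principal_bundle_category_def M)
  next
    case (3 X Y f)
    then show ?case using principal_bundle_morphisms_unit(1)[of f G X Y]
      by (auto simp: totally_fibred_subcategory_def principal_bundle_category_def)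
  next
    case (4 X Y f)
    then show ?case using principal_bundle_morphisms_unit(2)[of f G X Y]
      by (auto simp: totally_fibred_subcategory_def principal_bundle_category_def)
  next
    case 5
    then show ?case
      by (simp add: totally_fibred_subcategory_def principal_bundle_category_def pcomp_assoc)
  qed
  then show ?thesis using is_category_principal_bundle_category[of G]
    by (auto simp: subcategory_def totally_fibred_subcategory_def Let_def)
qed


section \<open>Classical principal bundles\<close>

record ('p, 'm, 'g, 'i) cbundle =
  ctotal :: "'p topology"
  cact :: "'p \<times> 'g \<Rightarrow> 'p"
  cbase :: "'m topology"
  cproj :: "'p \<Rightarrow> 'm"
  cindex :: "'i set"
  ccover :: "'i \<Rightarrow> 'm set"
  ctriv :: "'i \<Rightarrow> 'p \<Rightarrow> 'm \<times> 'g"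

definition continuous_right_action ::
  "'g topology \<Rightarrow> 'g monoid \<Rightarrow> 'p topology \<Rightarrow> ('p \<times> 'g \<Rightarrow> 'p) \<Rightarrow> bool" where
  "continuous_right_action T H P r \<longleftrightarrow>
     continuous_map (prod_topology P T) P r \<and>
     (\<forall>p\<in>topspace P. r (p, \<one>\<^bsub>H\<^esub>) = p) \<and>
     (\<forall>p\<in>topspace P. \<forall>g\<in>topspace T. \<forall>h\<in>topspace T. r (r (p, g), h) = r (p, g \<otimes>\<^bsub>H\<^esub> h))"

text \<open>As above, total functions are normalised outside their domains. \<open>T\<close> and \<open>H\<close> are the
  topology and the group structure of the structure group.\<close>

definition classical_bundle ::
  "'g topology \<Rightarrow> 'g monoid \<Rightarrow> 'm topology \<Rightarrow> ('p, 'm, 'g, 'i) cbundle \<Rightarrow> bool" where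
  "classical_bundle T H M B \<longleftrightarrow>
     (let P = ctotal B; r = cact B; q = cproj B; I = cindex B; U = ccover B; \<phi> = ctriv B;
          V = (\<lambda>i. {p \<in> topspace P. q p \<in> U i}) in
       cbase B = M \<and>
       r \<in> extensional (topspace P \<times> topspace T) \<and> q \<in> extensional (topspace P) \<and>
       U \<in> extensional I \<and> \<phi> \<in> extensional I \<and> (\<forall>i\<in>I. \<phi> i \<in> extensional (V i)) \<and>
       continuous_right_action T H P r \<and>
       continuous_map P M q \<and>
       (\<forall>p\<in>topspace P. \<forall>g\<in>topspace T. q (r (p, g)) = q p) \<and>
       (\<forall>i\<in>I. openin M (U i)) \<and> (\<Union>i\<in>I. U i) = topspace M \<and>
       (\<forall>i\<in>I.
          homeomorphic_map (subtopology P (V i)) (prod_topology (subtopology M (U i)) T) (\<phi> i) \<and>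
          (\<forall>p\<in>V i. fst (\<phi> i p) = q p) \<and>
          (\<forall>p\<in>V i. \<forall>h\<in>topspace T.
             \<phi> i (r (p, h)) = (fst (\<phi> i p), snd (\<phi> i p) \<otimes>\<^bsub>H\<^esub> h))))"

definition classical_morphisms ::
  "'g topology \<Rightarrow> ('p, 'm, 'g, 'i) cbundle \<Rightarrow> ('p, 'm, 'g, 'i) cbundle \<Rightarrow> ('p \<Rightarrow> 'p) set" where
  "classical_morphisms T B B' =
     {\<sigma> \<in> extensional (topspace (ctotal B)).
        continuous_map (ctotal B) (ctotal B') \<sigma> \<and>
        (\<forall>p\<in>topspace (ctotal B). \<forall>g\<in>topspace T. \<sigma> (cact B (p, g)) = cact B' (\<sigma> p, g)) \<and>
        (\<forall>p\<in>topspace (ctotal B). cproj B' (\<sigma> p) = cproj B p)}"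

definition classical_category ::
  "'g topology \<Rightarrow> 'g monoid \<Rightarrow> 'm topology \<Rightarrow>
   (('p, 'm, 'g, 'i) cbundle, 'p \<Rightarrow> 'p) category" where
  "classical_category T H M =
     \<lparr>Obj = {B. classical_bundle T H M B},
      Hom = classical_morphisms T,
      Id = (\<lambda>B. restrict id (topspace (ctotal B))),
      Comp = (\<lambda>B B' B'' \<sigma> \<rho>. compose (topspace (ctotal B)) \<rho> \<sigma>)\<rparr>"

end

theory Submission
  imports Defs
begin

text \<open>A chart of a categorical principal bundle is a partial isomorphism \<open>\<alpha>\<^sub>i : P \<rightarrow> M \<times> G\<close>, that is, a
  homeomorphism from an open subset of \<open>P\<close> onto an open subset of \<open>M \<times> G\<close>
  (\<open>partial_inverse_homeomorphic_maps\<close>, \<open>homeomorphic_map_partial_inverse\<close>). The condition on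
  \<open>\<alpha>\<^sub>i\<^sup>*\<close> makes its image \<open>U\<^sub>i \<times> G\<close>, where \<open>U\<^sub>i\<close> is the domain of \<open>e\<^sub>i\<close>. Two
  things separate such charts from local trivialisations: the domain of \<open>\<alpha>\<^sub>i\<close> could be smaller than
  \<open>q\<^sup>-\<^sup>1(U\<^sub>i)\<close>, and the \<open>U\<^sub>i\<close> might not cover \<open>M\<close>. Total fibredness excludes the first and
  surjectivity of \<open>q\<close> the second (\<open>chart_dom\<close>, \<open>base_cover\<close>).

  The remaining difference is that the classical notion has an action and equivariant charts, while
  the categorical one has transition functions. Each determines the other, because left and right
  translations commute and an equivariant self-map of \<open>G\<close> is the left translation by its value at
  \<open>1\<close>. Given transition functions, right multiplication in the charts is compatible with the changes
  of chart and so glues to a continuous action (\<open>chart_action_compatible\<close>). Given an action, an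
  equivariant change of coordinates \<open>(x, g) \<mapsto> (x, h)\<close> has \<open>h = \<tau>(x)g\<close>, where \<open>(x, \<tau>(x))\<close> is
  the image of \<open>(x, 1)\<close>; the cocycle laws follow from those for changes of coordinates
  (\<open>chart_change\<close>, \<open>transition_atlas\<close>).

  On morphisms, the equation \<open>\<Phi>q' = q\<close> with \<open>q\<close> total forces \<open>\<Phi>\<close> to be total, so that the morphisms
  over \<open>1\<^sub>M\<close> are exactly the equivariant continuous maps over \<open>M\<close> (\<open>hom_totally_fibred\<close>). The passage
  from classical to categorical bundles is thus a functor that is bijective on objects and on every
  hom-set, and such a functor is an isomorphism of categories (\<open>isomorphic_categoriesI\<close>).\<close>

section \<open>Partial maps as functional relations\<close>

text \<open>Almost every identity of partial maps below is proved through its graph: the rules below say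
  when each construction of the restriction category relates a point to a value.\<close>

lemma pmap_eqI: "(\<And>x y. f x = Some y \<longleftrightarrow> g x = Some y) \<Longrightarrow> f = g"
  by (rule ext) (metis option.exhaust)

lemma pcomp_Some: "(f \<Zcomp> g) x = Some z \<longleftrightarrow> (\<exists>y. f x = Some y \<and> g y = Some z)"
  by (auto simp: pcomp_def map_comp_def split: option.splits)

lemma pid_Some: "pid A x = Some y \<longleftrightarrow> x \<in> topspace A \<and> y = x"
  by (auto simp: pid_def)

lemma rst_Some: "rst f x = Some y \<longleftrightarrow> (\<exists>z. f x = Some z) \<and> y = x"
  by (auto simp: rst_def)

lemma ppair_Some: "ppair f g x = Some z \<longleftrightarrow> (\<exists>a b. f x = Some a \<and> g x = Some b \<and> z = (a, b))"
  by (auto simp: ppair_def)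

lemma ppi0_Some: "ppi0 A B z = Some x \<longleftrightarrow> fst z \<in> topspace A \<and> snd z \<in> topspace B \<and> x = fst z"
  by (cases z) (auto simp: ppi0_def)

lemma ppi1_Some: "ppi1 A B z = Some x \<longleftrightarrow> fst z \<in> topspace A \<and> snd z \<in> topspace B \<and> x = snd z"
  by (cases z) (auto simp: ppi1_def)

lemma pbang_Some: "pbang A x = Some y \<longleftrightarrow> x \<in> topspace A"
  by (auto simp: pbang_def)

lemma passoc_Some: "passoc A B C ((a, b), c) = Some z \<longleftrightarrow>
    a \<in> topspace A \<and> b \<in> topspace B \<and> c \<in> topspace C \<and> z = (a, b, c)"
  by (auto simp: passoc_def ppair_Some pcomp_Some ppi0_Some ppi1_Some)

lemmas pmap_Some = pcomp_Some pid_Some rst_Some ppair_Some ppi0_Some ppi1_Some pbang_Some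
  passoc_Some ptimes_Some

text \<open>Every partial map has the following form, by the rule \<open>pfun_the\<close>. It separates the domain of
  a partial map from its values, which is how classical data describe it.\<close>

definition pfun :: "'a set \<Rightarrow> ('a \<Rightarrow> 'b) \<Rightarrow> ('a \<rightharpoonup> 'b)" where
  "pfun A f = (\<lambda>x. if x \<in> A then Some (f x) else None)"

lemma pfun_Some: "pfun A f x = Some y \<longleftrightarrow> x \<in> A \<and> y = f x"
  by (auto simp: pfun_def)

lemma dom_pfun [simp]: "dom (pfun A f) = A"
  by (auto simp: pfun_def dom_def)

lemma pfun_the [simp]: "pfun (dom f) (\<lambda>x. the (f x)) = f"
  by (rule pmap_eqI) (auto simp: pfun_Some)

lemma pfun_eq_iff: "pfun A f = pfun B g \<longleftrightarrow> A = B \<and> (\<forall>x\<in>A. f x = g x)"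
proof
  assume eq: "pfun A f = pfun B g"
  then have AB: "A = B" by (metis dom_pfun)
  have "f x = g x" if "x \<in> A" for x
    using fun_cong[OF eq, of x] that AB by (simp add: pfun_def)
  with AB show "A = B \<and> (\<forall>x\<in>A. f x = g x)" by blast
qed (auto simp: pfun_def)

lemma pfun_pcomp: "pfun A f \<Zcomp> pfun B g = pfun {x \<in> A. f x \<in> B} (\<lambda>x. g (f x))"
  by (rule pmap_eqI) (auto simp: pcomp_Some pfun_Some)

lemma pfun_ptimes: "pfun A f \<times>\<^sub>p pfun B g = pfun (A \<times> B) (\<lambda>(x, y). (f x, g y))"
  by (rule pmap_eqI) (auto simp: ptimes_Some pfun_Some)

lemma pid_eq_pfun: "pid A = pfun (topspace A) (\<lambda>x. x)"
  by (simp add: pid_def pfun_def)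

lemma partop_pfun_iff:
  "pfun D f \<in> partop A B \<longleftrightarrow> openin A D \<and> continuous_map (subtopology A D) B f"
proof -
  have "continuous_map (subtopology A D) B (\<lambda>x. the (pfun D f x)) \<longleftrightarrow>
      continuous_map (subtopology A D) B f"
    by (intro iffI; erule continuous_map_eq) (auto simp: pfun_def)
  then show ?thesis by (simp add: partop_def)
qed

lemma total_map_iff: "total_map A B f \<longleftrightarrow> f \<in> partop A B \<and> dom f = topspace A"
proof -
  have "rst f = pid A \<longleftrightarrow> dom f = topspace A"
  proof
    assume "rst f = pid A"
    then have "rst f x = Some x \<longleftrightarrow> pid A x = Some x" for x by simp
    then show "dom f = topspace A" by (auto simp: pmap_Some)
  next
    assume "dom f = topspace A"
    then show "rst f = pid A" by (simp add: rst_def pid_def)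
  qed
  then show ?thesis by (simp add: total_map_def)
qed

lemma partop_total_iff:
  "dom f = topspace A \<Longrightarrow> f \<in> partop A B \<longleftrightarrow> continuous_map A B (\<lambda>x. the (f x))"
  by (simp add: partop_def)

lemma partop_ppair:
  assumes "f \<in> partop A B" "g \<in> partop A C"
  shows "ppair f g \<in> partop A (prod_topology B C)"
proof -
  have eq: "ppair f g = pfun (dom f \<inter> dom g) (\<lambda>x. (the (f x), the (g x)))"
    by (simp add: ppair_def pfun_def)
  have "continuous_map (subtopology A (dom f \<inter> dom g)) B (\<lambda>x. the (f x))"
    and "continuous_map (subtopology A (dom f \<inter> dom g)) C (\<lambda>x. the (g x))"
    using assms unfolding partop_def
    by (auto intro: continuous_map_from_subtopology_mono)
  then show ?thesis
    using assms unfolding eq partop_pfun_iff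
    by (auto simp: partop_def continuous_map_pairedI)
qed

lemma partop_ppi0: "ppi0 A B \<in> partop (prod_topology A B) A"
proof -
  have "ppi0 A B = pfun (topspace (prod_topology A B)) fst" by (simp add: ppi0_def pfun_def)
  then show ?thesis
    by (simp only: partop_pfun_iff subtopology_topspace openin_topspace continuous_map_fst)
qed

lemma partop_ppi1: "ppi1 A B \<in> partop (prod_topology A B) B"
proof -
  have "ppi1 A B = pfun (topspace (prod_topology A B)) snd" by (simp add: ppi1_def pfun_def)
  then show ?thesis
    by (simp only: partop_pfun_iff subtopology_topspace openin_topspace continuous_map_snd)
qed

lemma partop_pbang: "pbang A \<in> partop A pone"
proof -
  have "pbang A = pfun (topspace A) (\<lambda>x. ())" by (simp add: pbang_def pfun_def)
  then show ?thesis by (simp add: partop_pfun_iff pone_def)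
qed

lemma partop_ptimes:
  assumes f: "f \<in> partop A B" and g: "g \<in> partop C D"
  shows "f \<times>\<^sub>p g \<in> partop (prod_topology A C) (prod_topology B D)"
proof -
  have "f \<times>\<^sub>p g = ppair (ppi0 A C \<Zcomp> f) (ppi1 A C \<Zcomp> g)"
    using partop_values(1)[OF f] partop_values(1)[OF g]
    by (intro pmap_eqI) (auto simp: pmap_Some)
  then show ?thesis
    using partop_ppair[OF partop_pcomp[OF partop_ppi0 f] partop_pcomp[OF partop_ppi1 g]] by simp
qed

lemma partop_passoc:
  "passoc A B C \<in> partop (prod_topology (prod_topology A B) C)
     (prod_topology A (prod_topology B C))"
  unfolding passoc_def
  by (intro partop_ppair partop_pcomp[OF partop_ppi0] partop_ppi0 partop_ppi1)

text \<open>For a family agreeing on overlaps the choice in the definition of a join is immaterial, so the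
  graph of the join is the union of the graphs.\<close>

lemma pjoin_Some:
  assumes "\<And>i j x y z. i \<in> I \<Longrightarrow> j \<in> I \<Longrightarrow> f i x = Some y \<Longrightarrow> f j x = Some z \<Longrightarrow> y = z"
  shows "pjoin I f x = Some y \<longleftrightarrow> (\<exists>i\<in>I. f i x = Some y)"
proof (cases "\<exists>i\<in>I. x \<in> dom (f i)")
  case True
  define k where "k = (SOME i. i \<in> I \<and> x \<in> dom (f i))"
  have k: "k \<in> I \<and> x \<in> dom (f k)" unfolding k_def by (rule someI_ex) (use True in blast)
  have "pjoin I f x = f k x" using True by (simp add: pjoin_def k_def)
  with k show ?thesis by (auto dest: assms)
next
  case False
  then show ?thesis by (auto simp: pjoin_def)
qed

lemma partop_pjoin:
  assumes f: "\<And>i. i \<in> I \<Longrightarrow> f i \<in> partop A B"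
    and compat: "\<And>i j x y z. i \<in> I \<Longrightarrow> j \<in> I \<Longrightarrow> f i x = Some y \<Longrightarrow> f j x = Some z \<Longrightarrow> y = z"
  shows "pjoin I f \<in> partop A B"
proof -
  note join = pjoin_Some[of I f, OF compat]
  let ?D = "dom (pjoin I f)"
  have D: "?D = (\<Union>i\<in>I. dom (f i))" by (auto simp: join dom_def)
  have o: "openin A (dom (f i))" if "i \<in> I" for i using f[OF that] by (simp add: partop_def)
  have "continuous_map (subtopology A ?D) B (\<lambda>x. the (pjoin I f x))"
  proof (rule pasting_lemma[where I = I and T = "\<lambda>i. dom (f i)" and f = "\<lambda>i x. the (f i x)"])
    fix i assume i: "i \<in> I"
    then have sub: "dom (f i) \<subseteq> ?D" using D by blast
    then show "openin (subtopology A ?D) (dom (f i))"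
      using o[OF i] by (auto simp: openin_subtopology)
    show "continuous_map (subtopology (subtopology A ?D) (dom (f i))) B (\<lambda>x. the (f i x))"
      using f[OF i] sub by (simp add: partop_def subtopology_subtopology Int_absorb1)
  next
    fix i j x assume "i \<in> I" "j \<in> I" "x \<in> topspace (subtopology A ?D) \<inter> dom (f i) \<inter> dom (f j)"
    then show "the (f i x) = the (f j x)" using compat[of i j x] by auto
  next
    fix x assume "x \<in> topspace (subtopology A ?D)"
    then obtain y where "pjoin I f x = Some y" by auto
    moreover from this obtain i where "i \<in> I" "f i x = Some y" by (auto simp: join)
    ultimately show "\<exists>j. j \<in> I \<and> x \<in> dom (f j) \<and> the (pjoin I f x) = the (f j x)" by force
  qed
  moreover have "openin A ?D" unfolding D using o by blast
  ultimately show ?thesis by (simp add: partop_def)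
qed

lemma partial_inverse_iff:
  "partial_inverse A B f g \<longleftrightarrow>
     f \<in> partop A B \<and> g \<in> partop B A \<and> (\<forall>x y. f x = Some y \<longleftrightarrow> g y = Some x)"
proof -
  have "f \<Zcomp> g = rst f \<and> g \<Zcomp> f = rst g \<longleftrightarrow> (\<forall>x y. f x = Some y \<longleftrightarrow> g y = Some x)"
  proof
    assume l: "f \<Zcomp> g = rst f \<and> g \<Zcomp> f = rst g"
    have "(f \<Zcomp> g) x = Some x \<longleftrightarrow> rst f x = Some x" "(g \<Zcomp> f) y = Some y \<longleftrightarrow> rst g y = Some y"
      for x y using l by simp_all
    then show "\<forall>x y. f x = Some y \<longleftrightarrow> g y = Some x" by (auto simp: pmap_Some) (metis option.inject)+
  next
    assume "\<forall>x y. f x = Some y \<longleftrightarrow> g y = Some x"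
    then show "f \<Zcomp> g = rst f \<and> g \<Zcomp> f = rst g"
      by (intro conjI pmap_eqI; simp add: pmap_Some; metis option.inject)
  qed
  then show ?thesis by (auto simp: partial_inverse_def)
qed

lemma partial_inverse_pinv: "partial_iso A B f \<Longrightarrow> partial_inverse A B f (pinv A B f)"
  using pinv_eq by (metis partial_iso_def)

text \<open>The next two lemmas are the dictionary between charts in the two senses: a partial isomorphism is
  a homeomorphism between open subspaces.\<close>

lemma partial_inverse_homeomorphic_maps:
  assumes "partial_inverse A B f g"
  shows "homeomorphic_maps (subtopology A (dom f)) (subtopology B (dom g))
           (\<lambda>x. the (f x)) (\<lambda>y. the (g y))"
proof -
  have *: "f x = Some y \<longleftrightarrow> g y = Some x" for x y
    using assms by (simp add: partial_inverse_iff)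
  have inv: "the (g (the (f x))) = x" "the (f x) \<in> dom g" if "x \<in> dom f" for x
    using that *[of x "the (f x)"] by auto
  have inv': "the (f (the (g y))) = y" "the (g y) \<in> dom f" if "y \<in> dom g" for y
    using that *[of "the (g y)" y] by auto
  show ?thesis
    using assms inv inv'
    by (simp add: homeomorphic_maps_def continuous_map_in_subtopology partial_inverse_iff
        partop_def image_subset_iff)
qed

lemma homeomorphic_map_partial_inverse:
  assumes f: "homeomorphic_map (subtopology A V) (subtopology B W) f"
    and V: "openin A V" and W: "openin B W"
  shows "partial_inverse A B (pfun V f) (pfun W (inv_into V f))"
proof -
  have tV: "topspace (subtopology A V) = V" and tW: "topspace (subtopology B W) = W"
    using openin_subset[OF V] openin_subset[OF W] by auto
  have bij: "bij_betw f V W"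
    using f unfolding homeomorphic_eq_everything_map tV tW bij_betw_def by blast
  obtain g where g: "homeomorphic_maps (subtopology A V) (subtopology B W) f g"
    using f by (auto simp: homeomorphic_map_maps)
  have gi: "g y = inv_into V f y" if "y \<in> W" for y
  proof -
    have "g y \<in> V" "f (g y) = y"
      using g that tW unfolding homeomorphic_maps_def continuous_map_def by (auto simp: tV)
    then show ?thesis using bij by (metis bij_betw_def inv_into_f_f)
  qed
  have "continuous_map (subtopology B W) A (inv_into V f)"
    using g gi tW unfolding homeomorphic_maps_def continuous_map_in_subtopology
    by (metis continuous_map_eq)
  moreover have "continuous_map (subtopology A V) B f"
    using g unfolding homeomorphic_maps_def continuous_map_in_subtopology by auto
  moreover have "(x \<in> V \<and> y = f x) \<longleftrightarrow> (y \<in> W \<and> x = inv_into V f y)" for x y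
    using bij by (metis bij_betw_def bij_betw_inv_into_left f_inv_into_f imageI inv_into_into)
  ultimately show ?thesis
    unfolding partial_inverse_iff partop_pfun_iff pfun_Some using V W by blast
qed

section \<open>The structure group\<close>

locale structure_group =
  fixes G :: "'g group_data"
  assumes group_object: "group_object G"
begin

abbreviation T :: "'g topology" where "T \<equiv> gsp G"
abbreviation H :: "'g monoid" where "H \<equiv> points G"

sublocale group H
  rewrites "carrier H = topspace T"
  using group_object_topological_group[OF group_object]
  by (auto simp: topological_group_def points_def)

lemma gmul_total: "total_map (prod_topology T T) T (gmul G)"
  and gunit_total: "total_map pone T (gunit G)"
  and ginv_total: "total_map T T (ginv G)"
  using group_object by (simp_all add: group_object_def Let_def)

lemmas gmul_partop = gmul_total[unfolded total_map_iff, THEN conjunct1]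
lemmas gunit_partop = gunit_total[unfolded total_map_iff, THEN conjunct1]

lemma gmul_Some:
  "gmul G (g, h) = Some k \<longleftrightarrow> g \<in> topspace T \<and> h \<in> topspace T \<and> k = g \<otimes>\<^bsub>H\<^esub> h"
proof -
  have "dom (gmul G) = topspace T \<times> topspace T"
    using gmul_total by (simp add: total_map_iff)
  then have "(g, h) \<in> dom (gmul G) \<longleftrightarrow> g \<in> topspace T \<and> h \<in> topspace T" by simp
  then show ?thesis by (auto simp: points_def)
qed

lemma gunit_Some: "gunit G x = Some k \<longleftrightarrow> k = \<one>\<^bsub>H\<^esub>"
proof -
  have "dom (gunit G) = {()}" using gunit_total by (simp add: total_map_iff pone_def)
  then have "x \<in> dom (gunit G)" by simp
  then show ?thesis by (auto simp: points_def)
qed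

lemma ginv_Some: "ginv G g = Some k \<longleftrightarrow> g \<in> topspace T \<and> k = inv\<^bsub>H\<^esub> g"
proof (cases "g \<in> topspace T")
  case True
  have "dom (ginv G) = topspace T" using ginv_total by (simp add: total_map_iff)
  with True obtain h where h: "ginv G g = Some h" by blast
  have hT: "h \<in> topspace T"
    using partop_values(2)[of "ginv G" T T, OF _ h] ginv_total by (simp add: total_map_iff)
  have "ppair (ginv G) (pid T) \<Zcomp> gmul G = pbang T \<Zcomp> gunit G"
    using group_object by (simp add: group_object_def Let_def)
  then have "(ppair (ginv G) (pid T) \<Zcomp> gmul G) g = Some \<one>\<^bsub>H\<^esub>"
    using True by (simp add: pmap_Some gunit_Some)
  then have "h \<otimes>\<^bsub>H\<^esub> g = \<one>\<^bsub>H\<^esub>" using h by (auto simp: pmap_Some gmul_Some)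
  then have "inv\<^bsub>H\<^esub> g = h" using True hT by (metis inv_equality)
  then show ?thesis using True h by auto
next
  case False
  then show ?thesis using ginv_total partop_values(1)[of "ginv G" T T g k]
    by (auto simp: total_map_iff)
qed

end

section \<open>Categorical principal bundles, pointwise\<close>

text \<open>The graph of a chart inverse is the converse of the graph of the chart, so that every axiom is
  read below as a statement about the charts alone.\<close>

locale categorical_bundle = structure_group G for G :: "'g group_data" +
  fixes P :: "('p, 'm, 'g, 'i) pbundle"
  assumes principal: "principal_bundle G P"
begin

abbreviation E :: "'p topology" where "E \<equiv> ptotal P"
abbreviation M :: "'m topology" where "M \<equiv> pbase P"
abbreviation I :: "'i set" where "I \<equiv> pindex P"
abbreviation \<alpha> :: "'i \<Rightarrow> 'p \<rightharpoonup> 'm \<times> 'g" where "\<alpha> \<equiv> pchart P"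

lemma fibre_bundle: "fibre_bundle E M T (pproj P) I \<alpha> (pdom P)"
  using principal by (simp add: principal_bundle_def Let_def)

lemma proj_partop: "pproj P \<in> partop E M" and proj_dom: "dom (pproj P) = topspace E"
  using fibre_bundle by (simp_all add: fibre_bundle_def total_map_iff)

lemma chart_partial_inverse:
  "i \<in> I \<Longrightarrow> partial_inverse E (prod_topology M T) (\<alpha> i) (pchart_inv G P i)"
  using fibre_bundle by (intro partial_inverse_pinv) (simp add: fibre_bundle_def)

lemma chart_partop: "i \<in> I \<Longrightarrow> \<alpha> i \<in> partop E (prod_topology M T)"
  and chart_inv_partop: "i \<in> I \<Longrightarrow> pchart_inv G P i \<in> partop (prod_topology M T) E"
  and chart_inv_Some: "i \<in> I \<Longrightarrow> pchart_inv G P i z = Some p \<longleftrightarrow> \<alpha> i p = Some z"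
  using chart_partial_inverse[of i] unfolding partial_inverse_iff by blast+

lemma chart_values:
  assumes "i \<in> I" "\<alpha> i p = Some (x, g)"
  shows "p \<in> topspace E" "x \<in> topspace M" "g \<in> topspace T"
  using partop_values[OF chart_partop[OF assms(1)] assms(2)] by auto

lemma chart_inj: "i \<in> I \<Longrightarrow> \<alpha> i p = Some z \<Longrightarrow> \<alpha> i p' = Some z \<Longrightarrow> p = p'"
  by (metis chart_inv_Some option.inject)

lemma chart_proj:
  assumes "i \<in> I" "\<alpha> i p = Some (x, g)" shows "pproj P p = Some x"
proof -
  have "\<alpha> i \<Zcomp> ppi0 M T = rst (\<alpha> i) \<Zcomp> pproj P"
    using fibre_bundle assms(1) by (simp add: fibre_bundle_def)
  moreover have "(\<alpha> i \<Zcomp> ppi0 M T) p = Some x"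
    using assms chart_values[OF assms] by (simp add: pmap_Some)
  ultimately show ?thesis using assms(2) by (simp add: pmap_Some)
qed

lemma charts_cover: "(\<Union>i\<in>I. dom (\<alpha> i)) = topspace E"
proof -
  have eq: "pjoin I (\<lambda>i. rst (\<alpha> i)) = pid E"
    using fibre_bundle by (simp add: fibre_bundle_def)
  have "pjoin I (\<lambda>i. rst (\<alpha> i)) p = Some p \<longleftrightarrow> (\<exists>i\<in>I. rst (\<alpha> i) p = Some p)" for p
    by (rule pjoin_Some) (simp add: rst_Some)
  then have "p \<in> topspace E \<longleftrightarrow> (\<exists>i\<in>I. p \<in> dom (\<alpha> i))" for p
    unfolding eq by (simp add: pmap_Some dom_def)
  then show ?thesis by blast
qed

lemma pdom_partop: "i \<in> I \<Longrightarrow> pdom P i \<in> partop M M"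
  and pdom_Some: "i \<in> I \<Longrightarrow> pdom P i x = Some y \<longleftrightarrow> y = x \<and> x \<in> dom (pdom P i)"
proof -
  assume "i \<in> I"
  then have r: "pdom P i \<in> partop M M" "rst (pdom P i) = pdom P i"
    using fibre_bundle by (simp_all add: fibre_bundle_def restriction_idempotent_def)
  then show "pdom P i \<in> partop M M" by simp
  have "pdom P i x = Some y \<longleftrightarrow> rst (pdom P i) x = Some y" using r(2) by simp
  then show "pdom P i x = Some y \<longleftrightarrow> y = x \<and> x \<in> dom (pdom P i)" by (auto simp: rst_Some)
qed

lemma chart_range:
  assumes "i \<in> I"
  shows "(\<exists>p. \<alpha> i p = Some (x, g)) \<longleftrightarrow> x \<in> dom (pdom P i) \<and> g \<in> topspace T"
proof -
  have "rst (pchart_inv G P i) = pdom P i \<times>\<^sub>p pid T"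
    using fibre_bundle assms by (simp add: fibre_bundle_def)
  then have "rst (pchart_inv G P i) (x, g) = Some (x, g) \<longleftrightarrow>
      (pdom P i \<times>\<^sub>p pid T) (x, g) = Some (x, g)" by simp
  then show ?thesis by (simp add: pmap_Some chart_inv_Some[OF assms] pdom_Some[OF assms])
qed

lemma ptrans_partop: "i \<in> I \<Longrightarrow> j \<in> I \<Longrightarrow> ptrans P (i, j) \<in> partop M T"
proof -
  have "group_atlas G M I (ptrans P)"
    using principal by (simp add: principal_bundle_def Let_def)
  then show "i \<in> I \<Longrightarrow> j \<in> I \<Longrightarrow> ptrans P (i, j) \<in> partop M T"
    unfolding group_atlas_def by blast
qed

text \<open>This is the axiom on \<open>\<alpha>\<^sub>i\<^sup>* \<alpha>\<^sub>j\<close>. As an equality of partial maps it says where the composite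
  is defined as well as what its values are, hence an equivalence.\<close>

lemma chart_change:
  assumes i: "i \<in> I" and j: "j \<in> I"
  shows "(\<exists>p. \<alpha> i p = Some (x, g) \<and> \<alpha> j p = Some (y, h)) \<longleftrightarrow>
    g \<in> topspace T \<and> (\<exists>t. ptrans P (j, i) x = Some t \<and> y = x \<and> h = t \<otimes>\<^bsub>H\<^esub> g)"
proof -
  have eq: "pchart_inv G P i \<Zcomp> \<alpha> j =
      ppair (ppi0 M T) (ppair (ppi0 M T \<Zcomp> ptrans P (j, i)) (ppi1 M T) \<Zcomp> gmul G)"
    using principal i j by (simp add: principal_bundle_def Let_def)
  have "t \<in> topspace T \<and> x \<in> topspace M" if "ptrans P (j, i) x = Some t" for t
    using partop_values[OF ptrans_partop[OF j i] that] by simp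
  then have "(pchart_inv G P i \<Zcomp> \<alpha> j) (x, g) = Some (y, h) \<longleftrightarrow>
      g \<in> topspace T \<and> (\<exists>t. ptrans P (j, i) x = Some t \<and> y = x \<and> h = t \<otimes>\<^bsub>H\<^esub> g)"
    unfolding eq pmap_Some gmul_Some by (simp add: gmul_Some) blast
  then show ?thesis by (simp add: pcomp_Some chart_inv_Some[OF i])
qed

text \<open>A transition function is recovered from the charts by evaluating the change of coordinates at
  the unit.\<close>

lemma ptrans_Some:
  assumes i: "i \<in> I" and j: "j \<in> I"
  shows "ptrans P (j, i) x = Some t \<longleftrightarrow>
    (\<exists>p. \<alpha> i p = Some (x, \<one>\<^bsub>H\<^esub>) \<and> \<alpha> j p = Some (x, t))"
proof -
  have "s \<in> topspace T" if "ptrans P (j, i) x = Some s" for s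
    using partop_values(2)[OF ptrans_partop[OF j i] that] .
  then show ?thesis by (auto simp: chart_change[OF i j])
qed

text \<open>The member of the join defining \<open>r\<^sub>P\<close> that belongs to the chart \<open>i\<close>: it multiplies the group
  coordinate on the right.\<close>

definition chart_action :: "'i \<Rightarrow> 'p \<times> 'g \<rightharpoonup> 'p" where
  "chart_action i =
     (\<alpha> i \<times>\<^sub>p pid T) \<Zcomp> passoc M T T \<Zcomp> (pid M \<times>\<^sub>p gmul G) \<Zcomp> pchart_inv G P i"

lemma bundle_action_eq: "bundle_action G P = pjoin I chart_action"
  by (simp add: bundle_action_def chart_action_def[abs_def] Let_def)

lemma chart_action_Some:
  assumes i: "i \<in> I"
  shows "chart_action i (p, h) = Some p' \<longleftrightarrow> h \<in> topspace T \<and>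
    (\<exists>x g. \<alpha> i p = Some (x, g) \<and> \<alpha> i p' = Some (x, g \<otimes>\<^bsub>H\<^esub> h))"
  using chart_values[OF i]
  by (auto simp: chart_action_def pmap_Some chart_inv_Some[OF i] gmul_Some)

lemma chart_action_partop: "i \<in> I \<Longrightarrow> chart_action i \<in> partop (prod_topology E T) E"
  unfolding chart_action_def
  by (rule partop_pcomp partop_ptimes chart_partop partop_pid partop_passoc gmul_partop
      chart_inv_partop | assumption)+

text \<open>A change of chart multiplies the group coordinate on the left; since left and right
  multiplications commute, the local actions agree on overlaps.\<close>

lemma chart_action_compatible:
  assumes i: "i \<in> I" and j: "j \<in> I"
    and r: "chart_action i z = Some p'" "chart_action j z = Some p''"
  shows "p' = p''"
proof -
  obtain p h where z: "z = (p, h)" by (cases z)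
  obtain x g where h: "h \<in> topspace T" and p: "\<alpha> i p = Some (x, g)"
    and p': "\<alpha> i p' = Some (x, g \<otimes>\<^bsub>H\<^esub> h)"
    using r(1) by (auto simp: z chart_action_Some[OF i])
  obtain y k where pj: "\<alpha> j p = Some (y, k)" and p'': "\<alpha> j p'' = Some (y, k \<otimes>\<^bsub>H\<^esub> h)"
    using r(2) by (auto simp: z chart_action_Some[OF j])
  have g: "g \<in> topspace T" using chart_values(3)[OF i p] .
  from chart_change[OF i j, of x g y k] p pj obtain t where
    t: "ptrans P (j, i) x = Some t" "y = x" "k = t \<otimes>\<^bsub>H\<^esub> g" by blast
  from t(1) have "t \<in> topspace T"
    using ptrans_Some[OF i j] chart_values(3)[OF j] by blast
  then have "k \<otimes>\<^bsub>H\<^esub> h = t \<otimes>\<^bsub>H\<^esub> (g \<otimes>\<^bsub>H\<^esub> h)" using t g h by (simp add: m_assoc)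
  with t g h have "\<exists>q. \<alpha> i q = Some (x, g \<otimes>\<^bsub>H\<^esub> h) \<and> \<alpha> j q = Some (y, k \<otimes>\<^bsub>H\<^esub> h)"
    unfolding chart_change[OF i j] by auto
  then show ?thesis using chart_inj[OF i _ p'] chart_inj[OF j _ p''] by blast
qed

lemma bundle_action_Some_iff: "bundle_action G P z = Some p' \<longleftrightarrow> (\<exists>i\<in>I. chart_action i z = Some p')"
  unfolding bundle_action_eq by (rule pjoin_Some) (rule chart_action_compatible)

lemma bundle_action_partop: "bundle_action G P \<in> partop (prod_topology E T) E"
  unfolding bundle_action_eq
  by (rule partop_pjoin) (auto intro: chart_action_partop chart_action_compatible)

text \<open>By \<open>chart_range\<close> the image of a chart is a product with the whole group, so multiplying the
  group coordinate never leaves it. This is why the action is total.\<close>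

lemma chart_action_total:
  assumes i: "i \<in> I" and p: "\<alpha> i p = Some (x, g)" and h: "h \<in> topspace T"
  obtains p' where "bundle_action G P (p, h) = Some p'" "\<alpha> i p' = Some (x, g \<otimes>\<^bsub>H\<^esub> h)"
proof -
  have "x \<in> dom (pdom P i) \<and> g \<in> topspace T" using chart_range[OF i] p by blast
  with h have "x \<in> dom (pdom P i) \<and> g \<otimes>\<^bsub>H\<^esub> h \<in> topspace T" by simp
  then obtain p' where p': "\<alpha> i p' = Some (x, g \<otimes>\<^bsub>H\<^esub> h)" using chart_range[OF i] by blast
  then have "chart_action i (p, h) = Some p'" using p h by (auto simp: chart_action_Some[OF i])
  with i p' that show ?thesis by (auto simp: bundle_action_Some_iff)
qed

lemma bundle_action_dom: "dom (bundle_action G P) = topspace E \<times> topspace T"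
proof
  show "dom (bundle_action G P) \<subseteq> topspace E \<times> topspace T"
    using partop_values(1)[OF bundle_action_partop] by fastforce
next
  have "(p, h) \<in> dom (bundle_action G P)" if ph: "p \<in> topspace E" "h \<in> topspace T" for p h
  proof -
    obtain i where i: "i \<in> I" "p \<in> dom (\<alpha> i)" using ph charts_cover by blast
    then obtain x g where "\<alpha> i p = Some (x, g)" by auto
    from chart_action_total[OF i(1) this ph(2)] show ?thesis by blast
  qed
  then show "topspace E \<times> topspace T \<subseteq> dom (bundle_action G P)" by auto
qed

end

section \<open>From categorical to classical bundles\<close>

definition classical_of ::
  "'g group_data \<Rightarrow> ('p, 'm, 'g, 'i) pbundle \<Rightarrow> ('p, 'm, 'g, 'i) cbundle" where
  "classical_of G P =
     \<lparr>ctotal = ptotal P,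
      cact = restrict (\<lambda>z. the (bundle_action G P z)) (topspace (ptotal P) \<times> topspace (gsp G)),
      cbase = pbase P,
      cproj = restrict (\<lambda>p. the (pproj P p)) (topspace (ptotal P)),
      cindex = pindex P,
      ccover = restrict (\<lambda>i. dom (pdom P i)) (pindex P),
      ctriv = restrict (\<lambda>i. restrict (\<lambda>p. the (pchart P i p)) (dom (pchart P i))) (pindex P)\<rparr>"

context categorical_bundle
begin

abbreviation act :: "'p \<Rightarrow> 'g \<Rightarrow> 'p" where "act p h \<equiv> the (bundle_action G P (p, h))"

lemma bundle_action_Some:
  "p \<in> topspace E \<Longrightarrow> h \<in> topspace T \<Longrightarrow> bundle_action G P (p, h) = Some (act p h)"
  using bundle_action_dom by (metis SigmaI domD option.sel)

lemma act_closed: "p \<in> topspace E \<Longrightarrow> h \<in> topspace T \<Longrightarrow> act p h \<in> topspace E"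
  using partop_values(2)[OF bundle_action_partop bundle_action_Some] .

lemma chart_act:
  assumes "i \<in> I" "\<alpha> i p = Some (x, g)" "h \<in> topspace T"
  shows "\<alpha> i (act p h) = Some (x, g \<otimes>\<^bsub>H\<^esub> h)"
  by (rule chart_action_total[OF assms]) simp

lemma obtain_chart:
  assumes "p \<in> topspace E"
  obtains i x g where "i \<in> I" "\<alpha> i p = Some (x, g)" "x \<in> topspace M" "g \<in> topspace T"
proof -
  obtain i where i: "i \<in> I" "p \<in> dom (\<alpha> i)" using assms charts_cover by blast
  then obtain x g where "\<alpha> i p = Some (x, g)" by auto
  then show ?thesis using that i(1) chart_values by blast
qed

lemma act_one:
  assumes "p \<in> topspace E" shows "act p \<one>\<^bsub>H\<^esub> = p"
  using assms
proof (rule obtain_chart)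
  fix i x g assume i: "i \<in> I" "\<alpha> i p = Some (x, g)" "g \<in> topspace T"
  then show ?thesis using chart_act[OF i(1,2), of "\<one>\<^bsub>H\<^esub>"] chart_inj[OF i(1)] by simp
qed

lemma act_act:
  assumes "p \<in> topspace E" "h \<in> topspace T" "k \<in> topspace T"
  shows "act (act p h) k = act p (h \<otimes>\<^bsub>H\<^esub> k)"
  using assms(1)
proof (rule obtain_chart)
  fix i x g assume i: "i \<in> I" "\<alpha> i p = Some (x, g)" and g: "g \<in> topspace T"
  have "\<alpha> i (act (act p h) k) = Some (x, g \<otimes>\<^bsub>H\<^esub> (h \<otimes>\<^bsub>H\<^esub> k))"
    using chart_act[OF i(1) chart_act[OF i assms(2)] assms(3)] assms g by (simp add: m_assoc)
  then show ?thesis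
    using chart_act[OF i, of "h \<otimes>\<^bsub>H\<^esub> k"] chart_inj[OF i(1)] assms by simp
qed

lemma proj_act:
  assumes "p \<in> topspace E" "h \<in> topspace T" shows "pproj P (act p h) = pproj P p"
  using assms(1)
proof (rule obtain_chart)
  fix i x g assume i: "i \<in> I" "\<alpha> i p = Some (x, g)"
  show ?thesis
    using chart_proj[OF i] chart_proj[OF i(1) chart_act[OF i assms(2)]] by simp
qed

lemma act_continuous: "continuous_map (prod_topology E T) E (\<lambda>z. the (bundle_action G P z))"
  using bundle_action_partop partop_total_iff[of "bundle_action G P" "prod_topology E T"]
    bundle_action_dom by simp

lemma chart_homeomorphic_map:
  assumes i: "i \<in> I"
  shows "homeomorphic_map (subtopology E (dom (\<alpha> i)))
    (prod_topology (subtopology M (dom (pdom P i))) T) (\<lambda>p. the (\<alpha> i p))"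
proof -
  have "(x, g) \<in> dom (pchart_inv G P i) \<longleftrightarrow> x \<in> dom (pdom P i) \<and> g \<in> topspace T" for x g
    unfolding chart_range[OF i, symmetric] by (simp add: dom_def chart_inv_Some[OF i])
  then have "dom (pchart_inv G P i) = dom (pdom P i) \<times> topspace T"
    unfolding set_eq_iff split_paired_All by blast
  with partial_inverse_homeomorphic_maps[OF chart_partial_inverse[OF i]] show ?thesis
    unfolding prod_topology_subtopology by (metis homeomorphic_map_maps)
qed

end

text \<open>Total fibredness says that the domain of a chart is the full preimage of an open set of the
  base; surjectivity of the projection makes these open sets cover the base.\<close>

locale totally_fibred_bundle = categorical_bundle G P
  for G :: "'g group_data" and P :: "('p, 'm, 'g, 'i) pbundle" +
  assumes totally_fibred: "totally_fibred (pproj P) (pindex P) (pchart P) (pdom P)"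
    and surjective: "ran (pproj P) = topspace (pbase P)"
begin

lemma chart_dom:
  assumes i: "i \<in> I"
  shows "dom (\<alpha> i) = {p \<in> topspace E. the (pproj P p) \<in> dom (pdom P i)}"
proof -
  have "rst (\<alpha> i) = rst (pproj P \<Zcomp> pdom P i)"
    using totally_fibred i by (simp add: totally_fibred_def)
  then have "rst (\<alpha> i) p = Some p \<longleftrightarrow> rst (pproj P \<Zcomp> pdom P i) p = Some p" for p by simp
  then have "p \<in> dom (\<alpha> i) \<longleftrightarrow> (\<exists>x. pproj P p = Some x \<and> x \<in> dom (pdom P i))" for p
    by (simp add: rst_Some pcomp_Some dom_def) blast
  then have "p \<in> dom (\<alpha> i) \<longleftrightarrow> p \<in> topspace E \<and> the (pproj P p) \<in> dom (pdom P i)" for p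
    unfolding proj_dom[symmetric] by force
  then show ?thesis by blast
qed

lemma base_cover: "(\<Union>i\<in>I. dom (pdom P i)) = topspace M"
proof
  show "(\<Union>i\<in>I. dom (pdom P i)) \<subseteq> topspace M"
    using pdom_partop by (auto dest: partop_values(1))
next
  have "\<exists>i\<in>I. x \<in> dom (pdom P i)" if x: "x \<in> topspace M" for x
  proof -
    obtain p where p: "pproj P p = Some x" using x unfolding surjective[symmetric] ran_def by blast
    then have "p \<in> topspace E" using proj_dom by blast
    then show ?thesis
    proof (rule obtain_chart)
      fix i y g assume i: "i \<in> I" "\<alpha> i p = Some (y, g)"
      then have "y = x" using chart_proj[OF i] p by simp
      then show ?thesis using i chart_range[OF i(1)] by blast
    qed
  qed
  then show "topspace M \<subseteq> (\<Union>i\<in>I. dom (pdom P i))" by blast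
qed

lemma classical_of_classical: "classical_bundle T H M (classical_of G P)"
proof -
  let ?B = "classical_of G P"
  have E: "ctotal ?B = E" and q: "cproj ?B = restrict (\<lambda>p. the (pproj P p)) (topspace E)"
    and r: "cact ?B = restrict (\<lambda>z. the (bundle_action G P z)) (topspace E \<times> topspace T)"
    and I: "cindex ?B = I" and M: "cbase ?B = M"
    and U: "ccover ?B = restrict (\<lambda>i. dom (pdom P i)) I"
    and \<phi>: "ctriv ?B = restrict (\<lambda>i. restrict (\<lambda>p. the (\<alpha> i p)) (dom (\<alpha> i))) I"
    by (simp_all add: classical_of_def)
  have V: "{p \<in> topspace E. cproj ?B p \<in> ccover ?B i} = dom (\<alpha> i)" if "i \<in> I" for i
    using that by (auto simp: chart_dom q U)
  have "continuous_map (prod_topology E T) E (cact ?B)"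
    by (rule continuous_map_eq[OF act_continuous]) (simp add: r)
  then have action: "continuous_right_action T H E (cact ?B)"
    by (simp add: continuous_right_action_def r act_one act_act act_closed)
  have cont: "continuous_map E M (cproj ?B)"
    using proj_partop partop_total_iff[OF proj_dom]
    by (auto simp: q intro: continuous_map_eq)
  have inv: "cproj ?B (cact ?B (p, g)) = cproj ?B p"
    if "p \<in> topspace E" "g \<in> topspace T" for p g
    using that by (simp add: q r act_closed proj_act)
  have op: "openin M (ccover ?B i)" if "i \<in> I" for i
    using pdom_partop[OF that] that by (simp add: partop_def U)
  have cover: "(\<Union>i\<in>I. ccover ?B i) = topspace M"
    using base_cover by (simp add: U)
  have triv: "homeomorphic_map (subtopology E (dom (\<alpha> i)))
        (prod_topology (subtopology M (ccover ?B i)) T) (ctriv ?B i)"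
    if "i \<in> I" for i
    by (rule homeomorphic_map_eq[of _ _ "\<lambda>p. the (\<alpha> i p)"])
      (use that chart_homeomorphic_map[OF that] in \<open>auto simp: U \<phi>\<close>)
  have triv_proj: "fst (ctriv ?B i p) = cproj ?B p" if i: "i \<in> I" and p: "p \<in> dom (\<alpha> i)" for i p
  proof -
    obtain x g where xg: "\<alpha> i p = Some (x, g)" using p by auto
    then show ?thesis
      using i chart_proj[OF i xg] chart_values(1)[OF i xg] by (simp add: \<phi> q domI)
  qed
  have triv_act: "ctriv ?B i (cact ?B (p, h)) =
      (fst (ctriv ?B i p), snd (ctriv ?B i p) \<otimes>\<^bsub>H\<^esub> h)"
    if i: "i \<in> I" and p: "p \<in> dom (\<alpha> i)" and h: "h \<in> topspace T" for i p h
  proof -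
    obtain x g where xg: "\<alpha> i p = Some (x, g)" using p by auto
    then show ?thesis
      using i h chart_act[OF i xg h] chart_values(1)[OF i xg] by (simp add: \<phi> r domI)
  qed
  have ext: "cact ?B \<in> extensional (topspace E \<times> topspace T)"
      "cproj ?B \<in> extensional (topspace E)" "ccover ?B \<in> extensional I" "ctriv ?B \<in> extensional I"
    by (simp_all add: q r U \<phi>)
  have triv_ext: "ctriv ?B i \<in> extensional (dom (\<alpha> i))" if "i \<in> I" for i
    using that by (simp add: \<phi>)
  show ?thesis
    unfolding classical_bundle_def Let_def E I M
  proof (intro conjI ballI)
    show "cact ?B \<in> extensional (topspace E \<times> topspace T)" "cproj ?B \<in> extensional (topspace E)"
      "ccover ?B \<in> extensional I" "ctriv ?B \<in> extensional I" by fact+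
  qed (use action cont cover in \<open>simp_all add: V inv op triv triv_ext triv_proj triv_act del: domIff\<close>)
qed

end

section \<open>From classical to categorical bundles\<close>

definition chart_map :: "('p, 'm, 'g, 'i) cbundle \<Rightarrow> 'i \<Rightarrow> 'p \<rightharpoonup> 'm \<times> 'g" where
  "chart_map B i = pfun {p \<in> topspace (ctotal B). cproj B p \<in> ccover B i} (ctriv B i)"

text \<open>The transition function from the chart \<open>j\<close> to the chart \<open>i\<close> is the composite
  \<open>x \<mapsto> (x, 1) \<mapsto> \<phi>\<^sub>i (\<phi>\<^sub>j\<^sup>-\<^sup>1 (x, 1))\<close> followed by the second projection. As a composite of maps of
  \<open>ParTop\<close> it is continuous on an open domain by construction.\<close>

definition transition ::
  "'g group_data \<Rightarrow> ('p, 'm, 'g, 'i) cbundle \<Rightarrow> 'i \<Rightarrow> 'i \<Rightarrow> 'm \<rightharpoonup> 'g" where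
  "transition G B i j =
     ppair (pid (cbase B)) (pbang (cbase B) \<Zcomp> gunit G) \<Zcomp>
     pinv (ctotal B) (prod_topology (cbase B) (gsp G)) (chart_map B j) \<Zcomp>
     chart_map B i \<Zcomp> ppi1 (cbase B) (gsp G)"

definition categorical_of ::
  "'g group_data \<Rightarrow> ('p, 'm, 'g, 'i) cbundle \<Rightarrow> ('p, 'm, 'g, 'i) pbundle" where
  "categorical_of G B =
     \<lparr>ptotal = ctotal B,
      pbase = cbase B,
      pproj = pfun (topspace (ctotal B)) (cproj B),
      pindex = cindex B,
      pchart = restrict (chart_map B) (cindex B),
      pdom = restrict (\<lambda>i. pfun (ccover B i) (\<lambda>x. x)) (cindex B),
      ptrans = restrict (\<lambda>(i, j). transition G B i j) (cindex B \<times> cindex B)\<rparr>"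

locale classical_principal_bundle = structure_group G for G :: "'g group_data" +
  fixes M :: "'m topology" and B :: "('p, 'm, 'g, 'i) cbundle"
  assumes classical: "classical_bundle T H M B"
begin

abbreviation E :: "'p topology" where "E \<equiv> ctotal B"
abbreviation I :: "'i set" where "I \<equiv> cindex B"
abbreviation U :: "'i \<Rightarrow> 'm set" where "U \<equiv> ccover B"
abbreviation q :: "'p \<Rightarrow> 'm" where "q \<equiv> cproj B"
abbreviation r :: "'p \<times> 'g \<Rightarrow> 'p" where "r \<equiv> cact B"
abbreviation V :: "'i \<Rightarrow> 'p set" where "V i \<equiv> {p \<in> topspace E. q p \<in> U i}"
abbreviation \<phi> :: "'i \<Rightarrow> 'p \<Rightarrow> 'm \<times> 'g" where "\<phi> \<equiv> ctriv B"
abbreviation \<alpha> :: "'i \<Rightarrow> 'p \<rightharpoonup> 'm \<times> 'g" where "\<alpha> \<equiv> chart_map B"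
abbreviation chart_inv :: "'i \<Rightarrow> 'm \<times> 'g \<rightharpoonup> 'p" where
  "chart_inv i \<equiv> pinv E (prod_topology M T) (\<alpha> i)"

lemma base: "cbase B = M"
  and right_action: "continuous_right_action T H E r"
  and proj_continuous: "continuous_map E M q"
  and proj_act: "p \<in> topspace E \<Longrightarrow> g \<in> topspace T \<Longrightarrow> q (r (p, g)) = q p"
  and cover_open: "i \<in> I \<Longrightarrow> openin M (U i)"
  and cover: "(\<Union>i\<in>I. U i) = topspace M"
  and triv_homeomorphic:
    "i \<in> I \<Longrightarrow> homeomorphic_map (subtopology E (V i)) (prod_topology (subtopology M (U i)) T) (\<phi> i)"
  and triv_proj: "i \<in> I \<Longrightarrow> p \<in> V i \<Longrightarrow> fst (\<phi> i p) = q p"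
  and triv_act: "i \<in> I \<Longrightarrow> p \<in> V i \<Longrightarrow> h \<in> topspace T \<Longrightarrow>
    \<phi> i (r (p, h)) = (fst (\<phi> i p), snd (\<phi> i p) \<otimes>\<^bsub>H\<^esub> h)"
  using classical by (simp_all add: classical_bundle_def Let_def)

lemma extensionality: "r \<in> extensional (topspace E \<times> topspace T)" "q \<in> extensional (topspace E)"
  "U \<in> extensional I" "\<phi> \<in> extensional I" "i \<in> I \<Longrightarrow> \<phi> i \<in> extensional (V i)"
  using classical by (simp_all add: classical_bundle_def Let_def)

lemma act_closed: "p \<in> topspace E \<Longrightarrow> g \<in> topspace T \<Longrightarrow> r (p, g) \<in> topspace E"
  using right_action unfolding continuous_right_action_def continuous_map_def by force

lemma proj_closed: "p \<in> topspace E \<Longrightarrow> q p \<in> topspace M"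
  using proj_continuous by (auto simp: continuous_map_def)

lemma chart_Some: "\<alpha> i p = Some z \<longleftrightarrow> p \<in> topspace E \<and> q p \<in> U i \<and> z = \<phi> i p"
  by (auto simp: chart_map_def pfun_Some)

lemma chart_partial_inverse:
  assumes i: "i \<in> I"
  shows "partial_inverse E (prod_topology M T) (\<alpha> i) (chart_inv i)"
    and "dom (chart_inv i) = U i \<times> topspace T"
proof -
  have "openin E (V i)" using openin_continuous_map_preimage[OF proj_continuous cover_open[OF i]] .
  moreover have "openin (prod_topology M T) (U i \<times> topspace T)"
    using cover_open[OF i] by (simp add: openin_prod_Times_iff)
  ultimately have *: "partial_inverse E (prod_topology M T) (\<alpha> i)
      (pfun (U i \<times> topspace T) (inv_into (V i) (\<phi> i)))"
    unfolding chart_map_def using triv_homeomorphic[OF i]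
    by (intro homeomorphic_map_partial_inverse) (simp_all add: prod_topology_subtopology)
  show "partial_inverse E (prod_topology M T) (\<alpha> i) (chart_inv i)"
    and "dom (chart_inv i) = U i \<times> topspace T"
    using * by (simp_all add: pinv_eq[OF *])
qed

lemma chart_inv_Some: "i \<in> I \<Longrightarrow> chart_inv i z = Some p \<longleftrightarrow> \<alpha> i p = Some z"
  and chart_partop: "i \<in> I \<Longrightarrow> \<alpha> i \<in> partop E (prod_topology M T)"
  and chart_inv_partop: "i \<in> I \<Longrightarrow> chart_inv i \<in> partop (prod_topology M T) E"
  using chart_partial_inverse(1)[of i] unfolding partial_inverse_iff by blast+

lemma chart_inj: "i \<in> I \<Longrightarrow> \<alpha> i p = Some z \<Longrightarrow> \<alpha> i p' = Some z \<Longrightarrow> p = p'"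
  by (metis chart_inv_Some option.inject)

lemma chart_range:
  "i \<in> I \<Longrightarrow> (\<exists>p. \<alpha> i p = Some (x, g)) \<longleftrightarrow> x \<in> U i \<and> g \<in> topspace T"
  using chart_partial_inverse(2)[of i] by (simp add: set_eq_iff dom_def chart_inv_Some)

lemma chart_values:
  assumes "i \<in> I" "\<alpha> i p = Some (x, g)"
  shows "p \<in> topspace E" "q p = x" "x \<in> U i" "x \<in> topspace M" "g \<in> topspace T"
proof -
  show p: "p \<in> topspace E" and x: "q p = x"
    using assms triv_proj[of i p] by (auto simp: chart_Some) (metis fst_conv)
  show "x \<in> U i" "g \<in> topspace T" using chart_range[OF assms(1)] assms(2) by blast+
  show "x \<in> topspace M" using proj_closed[OF p] x by simp
qed

lemma chart_eq:
  assumes "i \<in> I" "p \<in> topspace E" "q p \<in> U i"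
  obtains g where "\<alpha> i p = Some (q p, g)" "g \<in> topspace T"
proof -
  have "\<alpha> i p = Some (q p, snd (\<phi> i p))"
    using assms triv_proj[of i p] by (simp add: chart_Some prod_eq_iff)
  with that chart_values(5)[OF assms(1) this] show ?thesis by blast
qed

lemma chart_act:
  assumes "i \<in> I" "\<alpha> i p = Some (x, g)" "h \<in> topspace T"
  shows "\<alpha> i (r (p, h)) = Some (x, g \<otimes>\<^bsub>H\<^esub> h)"
proof -
  have p: "p \<in> topspace E" "q p \<in> U i" "\<phi> i p = (x, g)" using assms(2) by (auto simp: chart_Some)
  with triv_act[of i p h] assms(1,3) show ?thesis
    by (simp add: chart_Some act_closed proj_act)
qed

lemma transition_Some:
  assumes "i \<in> I" "j \<in> I"
  shows "transition G B i j x = Some t \<longleftrightarrow>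
    (\<exists>p. \<alpha> j p = Some (x, \<one>\<^bsub>H\<^esub>) \<and> \<alpha> i p = Some (x, t))"
proof -
  have "transition G B i j x = Some t \<longleftrightarrow> x \<in> topspace M \<and>
      (\<exists>p y. \<alpha> j p = Some (x, \<one>\<^bsub>H\<^esub>) \<and> \<alpha> i p = Some (y, t) \<and> y \<in> topspace M \<and> t \<in> topspace T)"
    by (auto simp: transition_def base pmap_Some gunit_Some chart_inv_Some[OF assms(2)])
  moreover have "y = x" if "\<alpha> j p = Some (x, \<one>\<^bsub>H\<^esub>)" "\<alpha> i p = Some (y, t)" for p y
    using chart_values(2)[OF assms(2) that(1)] chart_values(2)[OF assms(1) that(2)] by simp
  ultimately show ?thesis using chart_values(4,5)[OF assms(1)] by metis
qed

lemma transition_partop: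
  assumes "i \<in> I" "j \<in> I" shows "transition G B i j \<in> partop M T"
  unfolding transition_def base
  using partop_ppair[OF partop_pid partop_pcomp[OF partop_pbang gunit_partop]]
    chart_inv_partop[OF assms(2)] chart_partop[OF assms(1)] partop_ppi1
  by (meson partop_pcomp)

text \<open>Every point of a fibre is a translate of the one with second coordinate \<open>1\<close> in the chart \<open>j\<close>.
  By equivariance the change of coordinates is therefore left multiplication by its value at
  \<open>1\<close>.\<close>

lemma chart_change:
  assumes i: "i \<in> I" and j: "j \<in> I" and p: "\<alpha> j p = Some (x, g)"
  shows "\<alpha> i p = Some (y, h) \<longleftrightarrow> (\<exists>t. transition G B i j x = Some t \<and> y = x \<and> h = t \<otimes>\<^bsub>H\<^esub> g)"
proof
  note g = chart_values(5)[OF j p]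
  assume pi: "\<alpha> i p = Some (y, h)"
  let ?p = "r (p, inv\<^bsub>H\<^esub> g)"
  have h: "h \<in> topspace T" and y: "y = x"
    using chart_values(2,5)[OF i pi] chart_values(2)[OF j p] by auto
  have "\<alpha> j ?p = Some (x, \<one>\<^bsub>H\<^esub>)" "\<alpha> i ?p = Some (x, h \<otimes>\<^bsub>H\<^esub> inv\<^bsub>H\<^esub> g)"
    using chart_act[OF j p, of "inv\<^bsub>H\<^esub> g"] chart_act[OF i pi, of "inv\<^bsub>H\<^esub> g"] g y by simp_all
  then have "transition G B i j x = Some (h \<otimes>\<^bsub>H\<^esub> inv\<^bsub>H\<^esub> g)"
    using transition_Some[OF i j] by blast
  moreover have "h = (h \<otimes>\<^bsub>H\<^esub> inv\<^bsub>H\<^esub> g) \<otimes>\<^bsub>H\<^esub> g" using g h by (simp add: m_assoc)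
  ultimately show "\<exists>t. transition G B i j x = Some t \<and> y = x \<and> h = t \<otimes>\<^bsub>H\<^esub> g" using y by blast
next
  note g = chart_values(5)[OF j p]
  assume "\<exists>t. transition G B i j x = Some t \<and> y = x \<and> h = t \<otimes>\<^bsub>H\<^esub> g"
  then obtain t p0 where y: "y = x" "h = t \<otimes>\<^bsub>H\<^esub> g"
    and p0: "\<alpha> j p0 = Some (x, \<one>\<^bsub>H\<^esub>)" "\<alpha> i p0 = Some (x, t)"
    using transition_Some[OF i j] by blast
  have "\<alpha> j (r (p0, g)) = Some (x, g)" using chart_act[OF j p0(1) g] g by simp
  then have "r (p0, g) = p" using chart_inj[OF j _ p] by blast
  then show "\<alpha> i p = Some (y, h)" using chart_act[OF i p0(2) g] y by simp
qed

lemma transition_cocycle: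
  assumes i: "i \<in> I" and j: "j \<in> I" and k: "k \<in> I"
    and s: "transition G B i j x = Some s" and t: "transition G B j k x = Some t"
  shows "transition G B i k x = Some (s \<otimes>\<^bsub>H\<^esub> t)"
proof -
  obtain p where p: "\<alpha> k p = Some (x, \<one>\<^bsub>H\<^esub>)" "\<alpha> j p = Some (x, t)"
    using t transition_Some[OF j k] by blast
  have "\<alpha> i p = Some (x, s \<otimes>\<^bsub>H\<^esub> t)" using chart_change[OF i j p(2)] s by blast
  with p(1) show ?thesis using transition_Some[OF i k] by blast
qed

lemma transition_refl:
  assumes i: "i \<in> I" and t: "transition G B i i x = Some t" shows "t = \<one>\<^bsub>H\<^esub>"
  using t unfolding transition_Some[OF i i] by auto

text \<open>The law \<open>\<tau>\<^sub>j\<^sub>i = \<tau>\<^sub>i\<^sub>j\<iota>\<close> of a group atlas is an equality of partial maps, so the domains of the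
  two sides have to be compared as well. Both are \<open>U\<^sub>i \<inter> U\<^sub>j\<close>.\<close>

lemma transition_dom:
  assumes i: "i \<in> I" and j: "j \<in> I"
  shows "x \<in> dom (transition G B i j) \<longleftrightarrow> x \<in> U i \<and> x \<in> U j"
proof
  assume "x \<in> dom (transition G B i j)"
  then obtain t p where "\<alpha> j p = Some (x, \<one>\<^bsub>H\<^esub>)" "\<alpha> i p = Some (x, t)"
    using transition_Some[OF i j] by blast
  then show "x \<in> U i \<and> x \<in> U j" using chart_values(3)[OF i] chart_values(3)[OF j] by blast
next
  assume x: "x \<in> U i \<and> x \<in> U j"
  then obtain p where p: "\<alpha> j p = Some (x, \<one>\<^bsub>H\<^esub>)" using chart_range[OF j] one_closed by blast
  have "p \<in> topspace E" "q p \<in> U i" using chart_values[OF j p] x by auto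
  then obtain t where "\<alpha> i p = Some (q p, t)" by (rule chart_eq[OF i])
  then have "transition G B i j x = Some t"
    using p chart_values(2)[OF j p] transition_Some[OF i j] by blast
  then show "x \<in> dom (transition G B i j)" by blast
qed

lemma transition_inverse:
  assumes i: "i \<in> I" and j: "j \<in> I"
  shows "transition G B j i = transition G B i j \<Zcomp> ginv G"
proof (rule pmap_eqI)
  have imp: "transition G B j i x = Some (inv\<^bsub>H\<^esub> s)" if s: "transition G B i j x = Some s" for x s
  proof -
    have "x \<in> dom (transition G B j i)" using s transition_dom[OF i j] transition_dom[OF j i] by blast
    then obtain t where t: "transition G B j i x = Some t" by blast
    have "t \<otimes>\<^bsub>H\<^esub> s = \<one>\<^bsub>H\<^esub>"
      using transition_refl[OF j transition_cocycle[OF j i j t s]] .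
    moreover have "s \<in> topspace T" "t \<in> topspace T"
      using partop_values(2)[OF transition_partop] i j s t by blast+
    ultimately show ?thesis using t by (metis inv_equality)
  qed
  fix x t
  show "transition G B j i x = Some t \<longleftrightarrow> (transition G B i j \<Zcomp> ginv G) x = Some t"
  proof
    assume t: "transition G B j i x = Some t"
    then have "x \<in> dom (transition G B i j)" using transition_dom[OF i j] transition_dom[OF j i] by blast
    then obtain s where s: "transition G B i j x = Some s" by blast
    have "s \<in> topspace T" using partop_values(2)[OF transition_partop[OF i j] s] .
    then show "(transition G B i j \<Zcomp> ginv G) x = Some t"
      using s t imp[OF s] by (simp add: pcomp_Some ginv_Some)
  next
    assume "(transition G B i j \<Zcomp> ginv G) x = Some t"
    then show "transition G B j i x = Some t" using imp by (auto simp: pcomp_Some ginv_Some)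
  qed
qed

lemma transition_atlas: "group_atlas G M I (\<lambda>(i, j)\<in>I \<times> I. transition G B i j)"
  unfolding group_atlas_def
proof (intro conjI ballI)
  fix i j assume i: "i \<in> I" and j: "j \<in> I"
  show "(\<lambda>(i, j)\<in>I \<times> I. transition G B i j) (i, j) \<in> partop M T"
    using transition_partop[OF i j] i j by simp
  show "(\<lambda>(i, j)\<in>I \<times> I. transition G B i j) (j, i) =
      (\<lambda>(i, j)\<in>I \<times> I. transition G B i j) (i, j) \<Zcomp> ginv G"
    using transition_inverse[OF i j] i j by simp
next
  fix i j k assume i: "i \<in> I" and j: "j \<in> I" and k: "k \<in> I"
  show "ppair ((\<lambda>(i, j)\<in>I \<times> I. transition G B i j) (i, j))
      ((\<lambda>(i, j)\<in>I \<times> I. transition G B i j) (j, k)) \<Zcomp> gmul G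
      \<subseteq>\<^sub>m (\<lambda>(i, j)\<in>I \<times> I. transition G B i j) (i, k)"
    using i j k
    by (auto simp: map_le_def pmap_Some gmul_Some dom_def transition_cocycle[OF i j k])
next
  fix i assume i: "i \<in> I"
  have "(pbang M \<Zcomp> gunit G) x = Some t" if t: "transition G B i i x = Some t" for x t
    using transition_refl[OF i t] partop_values(1)[OF transition_partop[OF i i] t]
    by (simp add: pmap_Some gunit_Some)
  then show "(\<lambda>(i, j)\<in>I \<times> I. transition G B i j) (i, i) \<subseteq>\<^sub>m pbang M \<Zcomp> gunit G"
    using i by (auto simp: map_le_def)
qed

lemma categorical_fibre_bundle:
  "fibre_bundle E M T (pfun (topspace E) q) I (restrict \<alpha> I) (\<lambda>i\<in>I. pfun (U i) (\<lambda>x. x))"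
  unfolding fibre_bundle_def
proof (intro conjI ballI)
  show "total_map E M (pfun (topspace E) q)"
    by (simp add: total_map_iff partop_pfun_iff proj_continuous)
next
  fix i assume i: "i \<in> I"
  show "partial_iso E (prod_topology M T) (restrict \<alpha> I i)"
    using chart_partial_inverse(1)[OF i] i by (auto simp: partial_iso_def)
  have "\<alpha> i \<Zcomp> ppi0 M T = rst (\<alpha> i) \<Zcomp> pfun (topspace E) q"
    using chart_values[OF i] by (intro pmap_eqI) (auto simp: pmap_Some pfun_Some)
  then show "restrict \<alpha> I i \<Zcomp> ppi0 M T = rst (restrict \<alpha> I i) \<Zcomp> pfun (topspace E) q"
    using i by simp
  have "restriction_idempotent M (pfun (U i) (\<lambda>x. x))"
    unfolding restriction_idempotent_def partop_pfun_iff
    using cover_open[OF i] openin_subset[OF cover_open[OF i]]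
    by (auto simp: rst_Some pfun_Some intro: pmap_eqI continuous_map_from_subtopology)
  then show "restriction_idempotent M ((\<lambda>i\<in>I. pfun (U i) (\<lambda>x. x)) i)" using i by simp
  have "rst (chart_inv i) = pfun (U i) (\<lambda>x. x) \<times>\<^sub>p pid T"
    by (intro pmap_eqI)
      (auto simp: rst_Some chart_inv_Some[OF i] chart_range[OF i] ptimes_Some pid_Some pfun_Some
        dest: chart_values(3)[OF i] chart_values(5)[OF i])
  then show "rst (pinv E (prod_topology M T) (restrict \<alpha> I i)) =
      (\<lambda>i\<in>I. pfun (U i) (\<lambda>x. x)) i \<times>\<^sub>p pid T"
    using i by simp
next
  have "pjoin I (\<lambda>i. rst (restrict \<alpha> I i)) p = Some p' \<longleftrightarrow> (\<exists>i\<in>I. rst (restrict \<alpha> I i) p = Some p')"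
    for p p'
    by (rule pjoin_Some) (simp add: rst_Some)
  moreover have "\<exists>i\<in>I. q p \<in> U i" if "p \<in> topspace E" for p
    using proj_closed[OF that] unfolding cover[symmetric] by blast
  ultimately show "pjoin I (\<lambda>i. rst (restrict \<alpha> I i)) = pid E"
    by (intro pmap_eqI) (auto simp: pmap_Some chart_Some)
qed

lemma chart_change_pmap:
  assumes i: "i \<in> I" and j: "j \<in> I"
  shows "chart_inv i \<Zcomp> \<alpha> j =
    ppair (ppi0 M T) (ppair (ppi0 M T \<Zcomp> transition G B j i) (ppi1 M T) \<Zcomp> gmul G)"
    (is "?l = ?r")
proof (rule pmap_eqI)
  fix z :: "'m \<times> 'g" and w :: "'m \<times> 'g"
  obtain x g y h where zw: "z = (x, g)" "w = (y, h)" by (cases z, cases w)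
  let ?P = "\<lambda>t. transition G B j i x = Some t \<and> y = x \<and> h = t \<otimes>\<^bsub>H\<^esub> g"
  have l: "?l z = Some w \<longleftrightarrow> (\<exists>p. \<alpha> i p = Some (x, g) \<and> \<alpha> j p = Some (y, h))"
    by (simp add: zw pcomp_Some chart_inv_Some[OF i])
  have "t \<in> topspace T \<and> x \<in> topspace M" if "transition G B j i x = Some t" for t
    using partop_values[OF transition_partop[OF j i] that] by simp
  then have r: "?r z = Some w \<longleftrightarrow> g \<in> topspace T \<and> (\<exists>t. ?P t)"
    unfolding zw pmap_Some by (simp add: gmul_Some) blast
  show "?l z = Some w \<longleftrightarrow> ?r z = Some w"
    unfolding l r
  proof
    assume "\<exists>p. \<alpha> i p = Some (x, g) \<and> \<alpha> j p = Some (y, h)"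
    then obtain p where p: "\<alpha> i p = Some (x, g)" "\<alpha> j p = Some (y, h)" by blast
    show "g \<in> topspace T \<and> (\<exists>t. ?P t)"
      using chart_change[OF j i p(1)] p(2) chart_values(5)[OF i p(1)] by blast
  next
    assume r: "g \<in> topspace T \<and> (\<exists>t. ?P t)"
    then have "x \<in> dom (transition G B j i)" by blast
    then have "x \<in> U i" using transition_dom[OF j i] by blast
    then obtain p where p: "\<alpha> i p = Some (x, g)" using r chart_range[OF i] by blast
    then show "\<exists>p. \<alpha> i p = Some (x, g) \<and> \<alpha> j p = Some (y, h)"
      using chart_change[OF j i p] r by blast
  qed
qed

lemma categorical_of_principal: "principal_bundle G (categorical_of G B)"
  unfolding principal_bundle_def Let_def
  using categorical_fibre_bundle transition_atlas chart_change_pmap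
  by (simp add: categorical_of_def base)

lemma categorical_of_totally_fibred:
  "totally_fibred (pfun (topspace E) q) I (restrict \<alpha> I) (\<lambda>i\<in>I. pfun (U i) (\<lambda>x. x))"
proof -
  have "rst (\<alpha> i) = rst (pfun (topspace E) q \<Zcomp> pfun (U i) (\<lambda>x. x))" for i
    by (intro pmap_eqI) (auto simp: pmap_Some pfun_Some chart_Some)
  then show ?thesis by (simp add: totally_fibred_def)
qed

lemma proj_surjective: "ran (pfun (topspace E) q) = topspace M"
proof
  show "ran (pfun (topspace E) q) \<subseteq> topspace M" by (auto simp: ran_def pfun_Some proj_closed)
next
  have "\<exists>p\<in>topspace E. q p = x" if "x \<in> topspace M" for x
  proof -
    obtain i where i: "i \<in> I" "x \<in> U i" using \<open>x \<in> topspace M\<close> cover by blast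
    then obtain p where "\<alpha> i p = Some (x, \<one>\<^bsub>H\<^esub>)" using chart_range[OF i(1)] one_closed by blast
    then show ?thesis using chart_values(1,2)[OF i(1)] by blast
  qed
  then show "topspace M \<subseteq> ran (pfun (topspace E) q)" by (force simp: ran_def pfun_Some)
qed

lemma categorical_of_totally_fibred_bundle: "totally_fibred_bundle G (categorical_of G B)"
proof (unfold_locales)
  show "principal_bundle G (categorical_of G B)" by (rule categorical_of_principal)
qed (use categorical_of_totally_fibred proj_surjective in \<open>simp_all add: categorical_of_def base\<close>)

end

section \<open>The two constructions are mutually inverse\<close>

text \<open>Nothing is lost in either direction, because the charts determine what only one of the two
  notions carries: the transition functions are changes of chart evaluated at the unit, and the
  action is fixed by its equivariance in the charts.\<close>

context totally_fibred_bundle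
begin

sublocale classical: classical_principal_bundle G "pbase P" "classical_of G P"
  by unfold_locales (rule classical_of_classical)

lemma chart_map_classical_of:
  assumes "i \<in> I" shows "chart_map (classical_of G P) i = \<alpha> i"
proof -
  have "chart_map (classical_of G P) i =
      pfun {p \<in> topspace E. the (pproj P p) \<in> dom (pdom P i)}
        (restrict (\<lambda>p. the (\<alpha> i p)) (dom (\<alpha> i)))"
    using assms by (simp add: chart_map_def classical_of_def del: domIff cong: conj_cong)
  also have "\<dots> = pfun (dom (\<alpha> i)) (\<lambda>p. the (\<alpha> i p))"
    unfolding chart_dom[OF assms, symmetric] by (simp add: pfun_eq_iff del: pfun_the)
  finally show ?thesis by simp
qed

lemma proj_classical_of: "pproj P = pfun (topspace E) (cproj (classical_of G P))"
proof -
  have "pproj P = pfun (topspace E) (\<lambda>p. the (pproj P p))"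
    using pfun_the[of "pproj P"] by (simp only: proj_dom)
  also have "\<dots> = pfun (topspace E) (cproj (classical_of G P))"
    by (simp add: pfun_eq_iff classical_of_def)
  finally show ?thesis .
qed

lemma action_classical_of:
  "bundle_action G P = pfun (topspace E \<times> topspace T) (cact (classical_of G P))"
proof -
  have "bundle_action G P = pfun (topspace E \<times> topspace T) (\<lambda>z. the (bundle_action G P z))"
    using pfun_the[of "bundle_action G P"] by (simp only: bundle_action_dom)
  also have "\<dots> = pfun (topspace E \<times> topspace T) (cact (classical_of G P))"
    by (simp add: pfun_eq_iff classical_of_def)
  finally show ?thesis .
qed

lemma categorical_of_classical_of: "categorical_of G (classical_of G P) = P"
proof (rule pbundle.equality)
  let ?B = "classical_of G P"
  have ext: "\<alpha> \<in> extensional I" "pdom P \<in> extensional I" "ptrans P \<in> extensional (I \<times> I)"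
    using principal by (simp_all add: principal_bundle_def Let_def)
  have I: "cindex ?B = I" by (simp add: classical_of_def)
  show "pproj (categorical_of G ?B) = pproj P"
    by (simp add: categorical_of_def proj_classical_of) (simp add: classical_of_def)
  show "pchart (categorical_of G ?B) = \<alpha>"
    by (rule extensionalityI[OF _ ext(1)])
      (simp_all add: categorical_of_def I chart_map_classical_of)
  show "pdom (categorical_of G ?B) = pdom P"
  proof (rule extensionalityI[OF _ ext(2)])
    fix i assume i: "i \<in> I"
    then show "pdom (categorical_of G ?B) i = pdom P i"
      by (intro pmap_eqI)
        (auto simp: categorical_of_def classical_of_def pfun_Some pdom_Some[OF i])
  qed (simp add: categorical_of_def I)
  show "ptrans (categorical_of G ?B) = ptrans P"
  proof (rule extensionalityI[OF _ ext(3)])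
    fix ij assume "ij \<in> I \<times> I"
    then obtain i j where ij: "ij = (i, j)" and i: "i \<in> I" and j: "j \<in> I" by blast
    have "transition G ?B i j = ptrans P (i, j)"
      using classical.transition_Some[of i j] i j
      by (intro pmap_eqI) (simp add: I ptrans_Some chart_map_classical_of)
    then show "ptrans (categorical_of G ?B) ij = ptrans P ij"
      using i j by (simp add: ij categorical_of_def I)
  qed (simp add: categorical_of_def I)
qed (simp_all add: categorical_of_def classical_of_def)

end

context classical_principal_bundle
begin

lemma classical_of_categorical_of: "classical_of G (categorical_of G B) = B"
proof (rule cbundle.equality)
  let ?P = "categorical_of G B"
  interpret P: totally_fibred_bundle G ?P by (rule categorical_of_totally_fibred_bundle)
  have E: "ptotal ?P = E" and I: "pindex ?P = I"
    and \<alpha>: "pchart ?P = restrict \<alpha> I" and e: "pdom ?P = (\<lambda>i\<in>I. pfun (U i) (\<lambda>x. x))"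
    by (simp_all add: categorical_of_def)
  show "cact (classical_of G ?P) = r"
  proof (rule extensionalityI[OF _ extensionality(1)])
    fix z assume "z \<in> topspace E \<times> topspace T"
    then obtain p h where z: "z = (p, h)" and p: "p \<in> topspace (ptotal ?P)" and h: "h \<in> topspace T"
      by (auto simp: E)
    \<comment> \<open>Both points have the same coordinates in a chart around \<open>p\<close>.\<close>
    from p have "P.act p h = r (p, h)"
    proof (rule P.obtain_chart)
      fix i x g assume i: "i \<in> pindex ?P" and xg: "pchart ?P i p = Some (x, g)"
      have iI: "i \<in> I" and a: "pchart ?P i = \<alpha> i" using i by (simp_all add: I \<alpha>)
      show ?thesis
        using P.chart_act[OF i xg h] chart_act[OF iI xg[unfolded a] h] chart_inj[OF iI]
        unfolding a by blast
    qed
    then show "cact (classical_of G ?P) z = r z"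
      using p h by (simp add: z classical_of_def E)
  qed (simp add: classical_of_def E)
  show "cproj (classical_of G ?P) = q"
    by (rule extensionalityI[OF _ extensionality(2)])
      (simp_all add: classical_of_def categorical_of_def pfun_def)
  show "ccover (classical_of G ?P) = U"
    by (rule extensionalityI[OF _ extensionality(3)]) (simp_all add: classical_of_def I e)
  show "ctriv (classical_of G ?P) = \<phi>"
  proof (rule extensionalityI[OF _ extensionality(4)])
    fix i assume i: "i \<in> I"
    have d: "dom (\<alpha> i) = V i" by (simp add: chart_map_def)
    have "restrict (\<lambda>p. the (\<alpha> i p)) (V i) = \<phi> i"
      by (rule extensionalityI[OF _ extensionality(5)[OF i]])
        (simp_all add: chart_map_def pfun_def)
    then have "restrict (\<lambda>p. the (\<alpha> i p)) (dom (\<alpha> i)) = \<phi> i" unfolding d .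
    then show "ctriv (classical_of G ?P) i = \<phi> i" using i by (simp add: classical_of_def I \<alpha>)
  qed (simp add: classical_of_def I)
qed (simp_all add: categorical_of_def classical_of_def)

end

section \<open>Morphisms\<close>

text \<open>A morphism over the identity is total: if \<open>\<Phi>\<close> were undefined at a point, then so would be
  \<open>\<Phi>q'\<close>, which equals the total map \<open>q\<close>.\<close>

lemma hom_totally_fibred:
  fixes P P' :: "('p, 'm, 'g, 'i) pbundle"
  assumes "totally_fibred_bundle G P" "totally_fibred_bundle G P'"
    and M: "pbase P = M" "pbase P' = M"
  shows "(\<Phi>, pid M) \<in> principal_bundle_morphisms G P P' \<longleftrightarrow>
    (\<exists>\<sigma>\<in>classical_morphisms (gsp G) (classical_of G P) (classical_of G P').
       \<Phi> = pfun (topspace (ptotal P)) \<sigma>)"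
proof -
  interpret P: totally_fibred_bundle G P by fact
  interpret P': totally_fibred_bundle G P' by fact
  let ?E = "ptotal P" and ?E' = "ptotal P'" and ?T = "gsp G"
  let ?q = "cproj (classical_of G P)" and ?q' = "cproj (classical_of G P')"
  let ?r = "cact (classical_of G P)" and ?r' = "cact (classical_of G P')"
  have tot: "ctotal (classical_of G P) = ?E" "ctotal (classical_of G P') = ?E'"
    by (simp_all add: classical_of_def)
  have q: "?q p \<in> topspace M" if "p \<in> topspace ?E" for p
    using P.classical.proj_closed that by (simp add: tot M)
  have r: "?r (p, h) \<in> topspace ?E" if "p \<in> topspace ?E" "h \<in> topspace ?T" for p h
    using P.classical.act_closed that by (simp add: tot)
  have total: "(pfun (topspace ?E) \<sigma>, pid M) \<in> principal_bundle_morphisms G P P' \<longleftrightarrow>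
      continuous_map ?E ?E' \<sigma> \<and>
      (\<forall>p\<in>topspace ?E. \<forall>g\<in>topspace ?T. \<sigma> (?r (p, g)) = ?r' (\<sigma> p, g)) \<and>
      (\<forall>p\<in>topspace ?E. ?q' (\<sigma> p) = ?q p)" for \<sigma>
  proof -
    have "pfun (topspace ?E) \<sigma> \<in> partop ?E ?E' \<longleftrightarrow> continuous_map ?E ?E' \<sigma>"
      by (simp add: partop_pfun_iff)
    moreover have "pfun (topspace ?E) \<sigma> \<Zcomp> pproj P' = pproj P \<Zcomp> pid M \<longleftrightarrow>
        (\<forall>p\<in>topspace ?E. ?q' (\<sigma> p) = ?q p)"
      if "\<And>p. p \<in> topspace ?E \<Longrightarrow> \<sigma> p \<in> topspace ?E'"
      using that q
      by (simp add: P.proj_classical_of P'.proj_classical_of pid_eq_pfun pfun_pcomp pfun_eq_iff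
          cong: conj_cong)
    moreover have "bundle_action G P \<Zcomp> pfun (topspace ?E) \<sigma> =
        (pfun (topspace ?E) \<sigma> \<times>\<^sub>p pid ?T) \<Zcomp> bundle_action G P' \<longleftrightarrow>
        (\<forall>p\<in>topspace ?E. \<forall>g\<in>topspace ?T. \<sigma> (?r (p, g)) = ?r' (\<sigma> p, g))"
      if "\<And>p. p \<in> topspace ?E \<Longrightarrow> \<sigma> p \<in> topspace ?E'"
    proof -
      have "{z \<in> topspace ?E \<times> topspace ?T. ?r z \<in> topspace ?E} = topspace ?E \<times> topspace ?T"
        using r by auto
      moreover have "{z \<in> topspace ?E \<times> topspace ?T.
          (case z of (p, h) \<Rightarrow> (\<sigma> p, h)) \<in> topspace ?E' \<times> topspace ?T} = topspace ?E \<times> topspace ?T"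
        using that by auto
      ultimately show ?thesis
        by (simp add: P.action_classical_of P'.action_classical_of pid_eq_pfun pfun_ptimes
            pfun_pcomp pfun_eq_iff)
    qed
    moreover have "\<sigma> p \<in> topspace ?E'" if "continuous_map ?E ?E' \<sigma>" "p \<in> topspace ?E" for p
      using that by (auto simp: continuous_map_def)
    ultimately show ?thesis
      unfolding principal_bundle_morphisms_def by (auto simp: M partop_pid)
  qed
  have dom: "dom \<Phi> = topspace ?E" if m: "(\<Phi>, pid M) \<in> principal_bundle_morphisms G P P'"
  proof
    have \<Phi>: "\<Phi> \<in> partop ?E ?E'" and eq: "\<Phi> \<Zcomp> pproj P' = pproj P \<Zcomp> pid M"
      using m by (auto simp: principal_bundle_morphisms_def)
    show "dom \<Phi> \<subseteq> topspace ?E" using partop_values(1)[OF \<Phi>] by blast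
    show "topspace ?E \<subseteq> dom \<Phi>"
    proof
      fix p assume p: "p \<in> topspace ?E"
      then have "(pproj P \<Zcomp> pid M) p = Some (?q p)"
        by (simp add: P.proj_classical_of pcomp_Some pfun_Some pid_Some q)
      then show "p \<in> dom \<Phi>" unfolding eq[symmetric] by (auto simp: pcomp_Some)
    qed
  qed
  show ?thesis
  proof
    assume m: "(\<Phi>, pid M) \<in> principal_bundle_morphisms G P P'"
    let ?\<sigma> = "restrict (\<lambda>p. the (\<Phi> p)) (topspace ?E)"
    have \<Phi>: "\<Phi> = pfun (topspace ?E) ?\<sigma>"
      unfolding dom[OF m, symmetric] by (rule pmap_eqI) (auto simp: pfun_Some)
    have "?\<sigma> \<in> classical_morphisms ?T (classical_of G P) (classical_of G P')"
      using m total[of ?\<sigma>] \<Phi> unfolding classical_morphisms_def tot by simp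
    with \<Phi> show "\<exists>\<sigma>\<in>classical_morphisms ?T (classical_of G P) (classical_of G P').
        \<Phi> = pfun (topspace ?E) \<sigma>" by blast
  next
    assume "\<exists>\<sigma>\<in>classical_morphisms ?T (classical_of G P) (classical_of G P').
        \<Phi> = pfun (topspace ?E) \<sigma>"
    then show "(\<Phi>, pid M) \<in> principal_bundle_morphisms G P P'"
      by (auto simp: classical_morphisms_def tot total)
  qed
qed

section \<open>The isomorphism of categories\<close>

text \<open>A functor that is bijective on objects and on every hom-set is an isomorphism; its inverse
  preserves identities and composition because the functor is faithful.\<close>

lemma isomorphic_categoriesI:
  fixes C :: "('o, 'a) category" and D :: "('q, 'b) category"
  assumes C: "is_category C" and D: "is_category D" and F: "is_functor C D Fo Fa"
    and Go: "\<And>Y. Y \<in> Obj D \<Longrightarrow> Go Y \<in> Obj C"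
    and GF: "\<And>X. X \<in> Obj C \<Longrightarrow> Go (Fo X) = X" and FG: "\<And>Y. Y \<in> Obj D \<Longrightarrow> Fo (Go Y) = Y"
    and bij: "\<And>X Y. X \<in> Obj C \<Longrightarrow> Y \<in> Obj C \<Longrightarrow>
      bij_betw (Fa X Y) (Hom C X Y) (Hom D (Fo X) (Fo Y))"
  shows "isomorphic_categories C D"
proof -
  define Ga where "Ga X Y = inv_into (Hom C (Go X) (Go Y)) (Fa (Go X) (Go Y))" for X Y
  have Fo: "Fo X \<in> Obj D" if "X \<in> Obj C" for X
    using F that by (simp add: is_functor_def)
  have Ga_hom: "Ga X Y f \<in> Hom C (Go X) (Go Y)" and Fa_Ga: "Fa (Go X) (Go Y) (Ga X Y f) = f"
    if "X \<in> Obj D" "Y \<in> Obj D" "f \<in> Hom D X Y" for X Y f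
    using bij[OF Go[OF that(1)] Go[OF that(2)]] that
    by (simp_all add: Ga_def FG bij_betw_def inv_into_into f_inv_into_f)
  have Ga_eq: "Ga X Y (Fa (Go X) (Go Y) f) = f"
    if "X \<in> Obj D" "Y \<in> Obj D" "f \<in> Hom C (Go X) (Go Y)" for X Y f
    using bij[OF Go[OF that(1)] Go[OF that(2)]] that by (simp add: Ga_def bij_betw_def)
  have "is_functor D C Go Ga"
    unfolding is_functor_def
  proof (intro conjI ballI)
    fix X assume X: "X \<in> Obj D"
    then show "Go X \<in> Obj C" by (rule Go)
    have "Id C (Go X) \<in> Hom C (Go X) (Go X)" using C Go[OF X] by (simp add: is_category_def)
    moreover have "Fa (Go X) (Go X) (Id C (Go X)) = Id D X"
      using F Go[OF X] by (simp add: is_functor_def FG[OF X])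
    ultimately show "Ga X X (Id D X) = Id C (Go X)" using Ga_eq[OF X X] by metis
  next
    fix X Y f assume "X \<in> Obj D" "Y \<in> Obj D" "f \<in> Hom D X Y"
    then show "Ga X Y f \<in> Hom C (Go X) (Go Y)" by (rule Ga_hom)
  next
    fix X Y Z f g
    assume X: "X \<in> Obj D" and Y: "Y \<in> Obj D" and Z: "Z \<in> Obj D"
      and f: "f \<in> Hom D X Y" and g: "g \<in> Hom D Y Z"
    let ?h = "Comp C (Go X) (Go Y) (Go Z) (Ga X Y f) (Ga Y Z g)"
    have "?h \<in> Hom C (Go X) (Go Z)"
      using C Go X Y Z Ga_hom[OF X Y f] Ga_hom[OF Y Z g] unfolding is_category_def by blast
    moreover have "Fa (Go X) (Go Z) ?h = Comp D X Y Z f g"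
      using F Go X Y Z Ga_hom[OF X Y f] Ga_hom[OF Y Z g]
      by (simp add: is_functor_def FG Fa_Ga f g)
    ultimately show "Ga X Z (Comp D X Y Z f g) = ?h" using Ga_eq[OF X Z] by metis
  qed
  moreover have "Ga (Fo X) (Fo Y) (Fa X Y f) = f"
    if "X \<in> Obj C" "Y \<in> Obj C" "f \<in> Hom C X Y" for X Y f
    using Ga_eq[OF Fo[OF that(1)] Fo[OF that(2)]] that by (simp add: GF)
  ultimately show ?thesis
    unfolding isomorphic_categories_def using C D F GF FG Fa_Ga by blast
qed

context structure_group
begin

lemma is_category_classical_category:
  fixes M :: "'m topology"
  shows "is_category
    (classical_category T H M :: (('p, 'm, 'g, 'i) cbundle, 'p \<Rightarrow> 'p) category)"
proof -
  have cl: "\<sigma> p \<in> topspace (ctotal B')" if "\<sigma> \<in> classical_morphisms T B B'" "p \<in> topspace (ctotal B)"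
    for \<sigma> p and B B' :: "('p, 'm, 'g, 'i) cbundle"
    using that by (auto simp: classical_morphisms_def continuous_map_def)
  have comp: "compose (topspace (ctotal B)) \<rho> \<sigma> \<in> classical_morphisms T B B''"
    if B: "classical_bundle T H M B" and \<sigma>: "\<sigma> \<in> classical_morphisms T B B'"
      and \<rho>: "\<rho> \<in> classical_morphisms T B' B''"
    for \<sigma> \<rho> and B B' B'' :: "('p, 'm, 'g, 'i) cbundle"
  proof -
    interpret B: classical_principal_bundle G M B by unfold_locales (rule B)
    have "continuous_map (ctotal B) (ctotal B'') (\<rho> \<circ> \<sigma>)"
      using \<sigma> \<rho> by (auto simp: classical_morphisms_def intro: continuous_map_compose)
    then have "continuous_map (ctotal B) (ctotal B'') (compose (topspace (ctotal B)) \<rho> \<sigma>)"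
      by (rule continuous_map_eq) (simp add: compose_def)
    then show ?thesis
      using \<sigma> \<rho> cl[OF \<sigma>] B.act_closed by (simp add: classical_morphisms_def compose_def)
  qed
  have ident: "restrict id (topspace (ctotal B)) \<in> classical_morphisms T B B"
    if "classical_bundle T H M B" for B :: "('p, 'm, 'g, 'i) cbundle"
  proof -
    interpret B: classical_principal_bundle G M B by unfold_locales (rule that)
    have "continuous_map (ctotal B) (ctotal B) (restrict id (topspace (ctotal B)))"
      by (rule continuous_map_eq[OF continuous_map_id]) simp
    then show ?thesis using B.act_closed by (simp add: classical_morphisms_def)
  qed
  have unit: "compose (topspace (ctotal B)) \<sigma> (restrict id (topspace (ctotal B))) = \<sigma>"
      "compose (topspace (ctotal B)) (restrict id (topspace (ctotal B'))) \<sigma> = \<sigma>"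
    if "\<sigma> \<in> classical_morphisms T B B'" for \<sigma> and B B' :: "('p, 'm, 'g, 'i) cbundle"
    using that cl[OF that]
    by (auto simp: classical_morphisms_def compose_def fun_eq_iff extensional_def)
  have assoc: "compose (topspace (ctotal B)) \<upsilon> (compose (topspace (ctotal B)) \<rho> \<sigma>) =
      compose (topspace (ctotal B)) (compose (topspace (ctotal B')) \<upsilon> \<rho>) \<sigma>"
    if "\<sigma> \<in> classical_morphisms T B B'" for \<sigma> and \<rho> \<upsilon> :: "'p \<Rightarrow> 'p" and B B' :: "('p, 'm, 'g, 'i) cbundle"
    using cl[OF that] by (auto simp: compose_def fun_eq_iff)
  show ?thesis
    unfolding is_category_def classical_category_def category.simps
    by (intro conjI ballI) (simp_all add: ident comp unit assoc)
qed

lemma totally_fibred_Obj_iff: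
  "P \<in> Obj (totally_fibred_subcategory G M) \<longleftrightarrow> totally_fibred_bundle G P \<and> pbase P = M"
  using structure_group_axioms
  by (auto simp: totally_fibred_subcategory_def principal_bundle_category_def
      totally_fibred_bundle_def totally_fibred_bundle_axioms_def categorical_bundle_def
      categorical_bundle_axioms_def)

lemma classical_Obj_iff:
  "B \<in> Obj (classical_category T H M) \<longleftrightarrow> classical_principal_bundle G M B"
  using structure_group_axioms
  by (auto simp: classical_category_def classical_principal_bundle_def
      classical_principal_bundle_axioms_def)

lemma bij_betw_Hom:
  fixes B B' :: "('p, 'm, 'g, 'i) cbundle"
  assumes B: "classical_principal_bundle G M B" and B': "classical_principal_bundle G M B'"
  shows "bij_betw (\<lambda>\<sigma>. (pfun (topspace (ctotal B)) \<sigma>, pid M)) (classical_morphisms T B B')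
    (Hom (totally_fibred_subcategory G M) (categorical_of G B) (categorical_of G B'))"
proof -
  interpret B: classical_principal_bundle G M B by fact
  interpret B': classical_principal_bundle G M B' by fact
  let ?F = "\<lambda>\<sigma>. (pfun (topspace (ctotal B)) \<sigma>, pid M)"
  have E: "ptotal (categorical_of G B) = ctotal B"
    and M: "pbase (categorical_of G B) = M" "pbase (categorical_of G B') = M"
    by (simp_all add: categorical_of_def B.base B'.base)
  have "(\<Phi>, pid M) \<in> principal_bundle_morphisms G (categorical_of G B) (categorical_of G B') \<longleftrightarrow>
      (\<exists>\<sigma>\<in>classical_morphisms T B B'. \<Phi> = pfun (topspace (ctotal B)) \<sigma>)" for \<Phi>
    using hom_totally_fibred[OF B.categorical_of_totally_fibred_bundle
        B'.categorical_of_totally_fibred_bundle M, of \<Phi>]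
    by (simp add: E B.classical_of_categorical_of B'.classical_of_categorical_of)
  then have "Hom (totally_fibred_subcategory G M) (categorical_of G B) (categorical_of G B') =
      ?F ` classical_morphisms T B B'"
    by (auto simp: totally_fibred_subcategory_def principal_bundle_category_def)
  moreover have "inj_on ?F (classical_morphisms T B B')"
    by (rule inj_onI) (auto simp: pfun_eq_iff classical_morphisms_def intro: extensionalityI)
  ultimately show ?thesis by (simp add: bij_betw_def)
qed

lemma isomorphic_classical_totally_fibred:
  fixes M :: "'m topology"
  shows "isomorphic_categories
    (classical_category T H M :: (('p, 'm, 'g, 'i) cbundle, 'p \<Rightarrow> 'p) category)
    (totally_fibred_subcategory G M ::
       (('p, 'm, 'g, 'i) pbundle, ('p \<rightharpoonup> 'p) \<times> ('m \<rightharpoonup> 'm)) category)"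
    (is "isomorphic_categories ?C ?D")
proof (rule isomorphic_categoriesI[where Go = "classical_of G"])
  let ?Fo = "categorical_of G :: ('p, 'm, 'g, 'i) cbundle \<Rightarrow> _"
  let ?Fa = "\<lambda>(B :: ('p, 'm, 'g, 'i) cbundle) (B' :: ('p, 'm, 'g, 'i) cbundle) \<sigma>.
    (pfun (topspace (ctotal B)) \<sigma> :: 'p \<rightharpoonup> 'p, pid M)"
  have Hom: "Hom ?C = classical_morphisms T"
    and Comp: "Comp ?C B B' B'' \<sigma> \<rho> = compose (topspace (ctotal B)) \<rho> \<sigma>"
    for B B' B'' \<sigma> \<rho>
    by (simp_all add: classical_category_def)
  have Fo: "?Fo B \<in> Obj ?D" if "B \<in> Obj ?C" for B
  proof -
    interpret B: classical_principal_bundle G M B using that by (simp add: classical_Obj_iff)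
    show ?thesis
      using B.categorical_of_totally_fibred_bundle
      by (simp add: totally_fibred_Obj_iff categorical_of_def B.base)
  qed
  show bij: "bij_betw (?Fa B B') (Hom ?C B B') (Hom ?D (?Fo B) (?Fo B'))"
    if "B \<in> Obj ?C" "B' \<in> Obj ?C" for B B'
    using that by (simp add: classical_Obj_iff Hom bij_betw_Hom)
  show "is_category ?C" by (rule is_category_classical_category)
  show "is_category ?D" 
    by (rule subcategory_totally_fibred[unfolded subcategory_def, THEN conjunct2, THEN conjunct1])
  show "is_functor ?C ?D ?Fo ?Fa"
    unfolding is_functor_def
  proof (intro conjI ballI)
    fix B assume B: "B \<in> Obj ?C"
    then show "?Fo B \<in> Obj ?D" by (rule Fo)
    have "cbase B = M" using B by (simp add: classical_category_def classical_bundle_def Let_def)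
    then show "?Fa B B (Id ?C B) = Id ?D (?Fo B)"
      by (simp add: classical_category_def totally_fibred_subcategory_def
          principal_bundle_category_def categorical_of_def pid_eq_pfun pfun_eq_iff)
  next
    fix B B' \<sigma> assume "B \<in> Obj ?C" "B' \<in> Obj ?C" "\<sigma> \<in> Hom ?C B B'"
    then show "?Fa B B' \<sigma> \<in> Hom ?D (?Fo B) (?Fo B')" by (rule bspec[OF bij_betwE[OF bij]])
  next
    fix B B' B'' \<sigma> \<rho> assume \<sigma>: "\<sigma> \<in> Hom ?C B B'"
    have "pid M \<Zcomp> pid M = pid M" by (rule pid_pcomp) (simp add: pid_Some)
    moreover have "{p \<in> topspace (ctotal B). \<sigma> p \<in> topspace (ctotal B')} = topspace (ctotal B)"
      using \<sigma> by (auto simp: Hom classical_morphisms_def continuous_map_def)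
    ultimately show "?Fa B B'' (Comp ?C B B' B'' \<sigma> \<rho>) =
        Comp ?D (?Fo B) (?Fo B') (?Fo B'') (?Fa B B' \<sigma>) (?Fa B' B'' \<rho>)"
      by (simp add: Comp totally_fibred_subcategory_def principal_bundle_category_def
          pfun_pcomp pfun_eq_iff compose_def)
  qed
  show "classical_of G P \<in> Obj ?C" "?Fo (classical_of G P) = P" if "P \<in> Obj ?D" for P
  proof -
    from that interpret P: totally_fibred_bundle G P by (simp add: totally_fibred_Obj_iff)
    have "pbase P = M" using that by (simp add: totally_fibred_Obj_iff)
    then show "classical_of G P \<in> Obj ?C"
      using P.classical_of_classical by (simp add: classical_category_def)
    show "?Fo (classical_of G P) = P" by (rule P.categorical_of_classical_of)
  qed
  show "classical_of G (?Fo B) = B" if "B \<in> Obj ?C" for B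
    using that classical_principal_bundle.classical_of_categorical_of by (simp add: classical_Obj_iff)
qed

end

theorem theorem9:
  fixes G :: "'g group_data" and M :: "'m topology"
  assumes "group_object G"
  shows "isomorphic_categories
           (classical_category (gsp G) (points G) M ::
              (('p, 'm, 'g, 'i) cbundle, 'p \<Rightarrow> 'p) category)
           (totally_fibred_subcategory G M ::
              (('p, 'm, 'g, 'i) pbundle, ('p \<rightharpoonup> 'p) \<times> ('m \<rightharpoonup> 'm)) category)"
proof -
  interpret structure_group G by unfold_locales (rule assms)
  show ?thesis by (rule isomorphic_classical_totally_fibred)
qed

end
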